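(* Let $\alpha,\beta>-1$. There is a constant $C'_{\alpha,\beta}$, independent of $n$, $q$ and $f$, such that for every $q\in(1/2,1)$, every integer $n\ge1$ and every differentiable $f:[0,1]\to\mathbb R$ with $f'$ continuous on $[0,1]$, $$\left\|D_q(M_{n,q}^{\alpha,\beta}f)-f'\right\|_\infty\le C'_{\alpha,\beta}\left(\omega\!\left(f',\frac1{\sqrt{[n]_q}}\right)+\omega(f',1-q)\right)+\frac{[\alpha+\beta+2]_q}{[n]_q}\,\|f'\|_\infty.$$ Hence, if $(q_n)$ is a sequence in $(0,1)$ with $\lim_{n\to\infty}q_n=1$, then $\lim_{n\to\infty}D_{q_n}(M_{n,q_n}^{\alpha,\beta}f)(x)=f'(x)$ uniformly on $[0,1]$.
   Context: $\|\cdot\|_\infty$ is the uniform norm on $[0,1]$ and $\omega(g,\delta)=\sup\{|g(x)-g(y)|:x,y\in[0,1],\ |x-y|\le\delta\}$ is the usual modulus of continuity. The $q$-derivative is $D_qh(x)=\frac{h(qx)-h(x)}{(q-1)x}$ for $x\neq0$, and $D_qh(0)=h'(0)$ for a polynomial $h$. For real $a$, $[a]_q=\frac{1-q^a}{1-q}$; $[n]_q!=\prod_{j=1}^n[j]_q$; $\begin{bmatrix}n\\k\end{bmatrix}_q=\frac{[n]_q!}{[k]_q!\,[n-k]_q!}$. For real $a$, $(1-x)_q^a=\prod_{j=0}^\infty\frac{1-q^jx}{1-q^{j+a}x}$. The Jackson integral is $\int_0^ah(t)\,d_qt=a(1-q)\sum_{i\ge0}q^ih(q^ia)$. Put $b_{n,k,q}(x)=\begin{bmatrix}n\\k\end{bmatrix}_qx^k(1-x)_q^{n-k}$,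 $0\le k\le n$, and $$M_{n,q}^{\alpha,\beta}f(x)=\sum_{k=0}^n f_{n,k,q}^{\alpha,\beta}\,b_{n,k,q}(x),\qquad f_{n,k,q}^{\alpha,\beta}=\frac{\int_0^1t^{k+\alpha}(1-qt)_q^{n-k+\beta}f(q^{\beta+1}t)\,d_qt}{\int_0^1t^{k+\alpha}(1-qt)_q^{n-k+\beta}\,d_qt}.$$ *)

theory Defs
  imports "HOL-Analysis.Analysis"
begin

definition q_num :: "real \<Rightarrow> real \<Rightarrow> real" where
  "q_num q a = (1 - q powr a) / (1 - q)"

definition q_fact :: "real \<Rightarrow> nat \<Rightarrow> real" where
  "q_fact q n = (\<Prod>j = 1..n. q_num q (real j))"

definition q_binomial :: "real \<Rightarrow> nat \<Rightarrow> nat \<Rightarrow> real" where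
  "q_binomial q n k = q_fact q n / (q_fact q k * q_fact q (n - k))"

text \<open>
  \<open>q_pow q x a\<close> is $(1-x)_q^a$. For \<open>a = 0\<close> every factor of the infinite product cancels to \<open>1\<close>,
  but for \<open>x = 1\<close> the factor with \<open>j = 0\<close> reads \<open>0 / 0\<close>, which is \<open>0\<close> in HOL. The case distinction
  restores the value \<open>1\<close>, so that $x \mapsto (1-x)_q^0$ is the constant polynomial \<open>1\<close> up to and
  including \<open>x = 1\<close>. For \<open>a > 0\<close> and \<open>x \<le> 1\<close> no denominator vanishes.
\<close>

definition q_pow :: "real \<Rightarrow> real \<Rightarrow> real \<Rightarrow> real" where
  "q_pow q x a =
     (if a = 0 then 1 else (\<Prod>j. (1 - q ^ j * x) / (1 - q powr (real j + a) * x)))"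

definition jackson_integral :: "real \<Rightarrow> real \<Rightarrow> (real \<Rightarrow> real) \<Rightarrow> real" where
  "jackson_integral q a h = a * (1 - q) * (\<Sum>i. q ^ i * h (q ^ i * a))"

definition q_deriv :: "real \<Rightarrow> (real \<Rightarrow> real) \<Rightarrow> real \<Rightarrow> real" where
  "q_deriv q h x = (if x = 0 then deriv h 0 else (h (q * x) - h x) / ((q - 1) * x))"

definition q_bernstein :: "nat \<Rightarrow> nat \<Rightarrow> real \<Rightarrow> real \<Rightarrow> real" where
  "q_bernstein n k q x = q_binomial q n k * x ^ k * q_pow q x (real n - real k)"

definition q_durrmeyer_coeff ::
    "real \<Rightarrow> real \<Rightarrow> nat \<Rightarrow> nat \<Rightarrow> real \<Rightarrow> (real \<Rightarrow> real) \<Rightarrow> real" where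
  "q_durrmeyer_coeff \<alpha> \<beta> n k q f =
     jackson_integral q 1 (\<lambda>t. t powr (real k + \<alpha>) * q_pow q (q * t) (real n - real k + \<beta>)
                                 * f (q powr (\<beta> + 1) * t))
     / jackson_integral q 1 (\<lambda>t. t powr (real k + \<alpha>) * q_pow q (q * t) (real n - real k + \<beta>))"

definition q_durrmeyer ::
    "real \<Rightarrow> real \<Rightarrow> nat \<Rightarrow> real \<Rightarrow> (real \<Rightarrow> real) \<Rightarrow> real \<Rightarrow> real" where
  "q_durrmeyer \<alpha> \<beta> n q f x =
     (\<Sum>k = 0..n. q_durrmeyer_coeff \<alpha> \<beta> n k q f * q_bernstein n k q x)"

definition unif_norm :: "(real \<Rightarrow> real) \<Rightarrow> real" where
  "unif_norm g = (SUP x\<in>{0..1}. \<bar>g x\<bar>)"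

definition modulus_of_continuity :: "(real \<Rightarrow> real) \<Rightarrow> real \<Rightarrow> real" where
  "modulus_of_continuity g \<delta> =
     Sup {\<bar>g x - g y\<bar> | x y. x \<in> {0..1} \<and> y \<in> {0..1} \<and> \<bar>x - y\<bar> \<le> \<delta>}"

definition C1_with_deriv :: "(real \<Rightarrow> real) \<Rightarrow> (real \<Rightarrow> real) \<Rightarrow> bool" where
  "C1_with_deriv f f' \<longleftrightarrow>
     (\<forall>x\<in>{0..1}. (f has_real_derivative f' x) (at x within {0..1})) \<and> continuous_on {0..1} f'"

end

theory Submission
  imports Defs
begin

text \<open>
  The proof rests on one intertwining relation. For \<open>n = m + 1\<close>,
  $$D_q\bigl(M_{n,q}^{\alpha,\beta}f\bigr)(x)=\lambda\sum_{k=0}^{m}b_{m,k,q}(qx)\,E_k\bigl[f'(\xi_i)\bigr],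
    \qquad \lambda=q^{\alpha+\beta+2}\frac{[n]_q}{[n+\alpha+\beta+2]_q},$$
  where $E_k$ is the normalised Jackson mean belonging to the degree \<open>m\<close> and the parameters
  $\alpha+1$, $\beta+1$, and $\xi_i$ lies between the nodes $q^{\beta+2+i}$ and $q^{\beta+1+i}$. So the
  $q$-derivative of the operator is again a positive operator of the same family, acting on $f'$.

  Two summations by parts give it. In the index \<open>k\<close>, the $q$-derivative of the $q$-Bernstein basis
  turns the coefficients into their differences (\<open>bernstein_q_diff\<close>). In the lattice index
  \<open>i\<close>, the difference of two neighbouring coefficients is the mean of the difference quotients of
  \<open>f\<close> with both Beta parameters raised (\<open>beta_mean_diff\<close>, which rests on
  \<open>beta_abel_summation\<close>). The mean value theorem then brings in $f'$.

  The estimate is that of a positive operator reproducing constants. Its second moment around $y=qx$ is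
  at most a constant over $[n]_q$, uniformly in \<open>q\<close> (\<open>durrmeyer_mean_sq_dev\<close>), so
  $|f'(u)-f'(y)|\le\omega(f',\delta)(1+(u-y)^2/\delta^2)$ with $\delta=[n]_q^{-1/2}$ contributes a multiple of
  $\omega(f',\delta)$. The distances from $\xi_i$ to the nodes and from $qx$ to \<open>x\<close> are at most $1-q$ and contribute
  $\omega(f',1-q)$. Finally $1-\lambda=[\alpha+\beta+2]_q/[n+\alpha+\beta+2]_q\le[\alpha+\beta+2]_q/[n]_q$ accounts
  for the term with $\|f'\|_\infty$. Uniform convergence follows because $q_n\to1$ forces
  $[n]_{q_n}\to\infty$.
\<close>

section \<open>The lattice weights of the Jackson integral\<close>

text \<open>
  The $q$-shifted factorial $(x;q)_\infty$.
\<close>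

definition q_poch_inf :: "real \<Rightarrow> real \<Rightarrow> real" where
  "q_poch_inf q x = (\<Prod>j. 1 - q ^ j * x)"

text \<open>
  Up to the factor $1-q$, the weight of the node $t=q^i$ in the Jackson integral
  $\int_0^1 t^{a-1}(1-qt)_q^{b-1}\,\cdot\,d_qt$. The factor $(1-qt)_q^{b-1}$ is kept as the quotient
  $(q^{i+1};q)_\infty/(q^{i+b};q)_\infty$, which makes a shift of \<open>b\<close> by one visible as a
  single linear factor.
\<close>

definition beta_weight :: "real \<Rightarrow> real \<Rightarrow> real \<Rightarrow> nat \<Rightarrow> real" where
  "beta_weight q a b i =
     (q powr a) ^ i * q_poch_inf q (q ^ Suc i) / q_poch_inf q (q powr (real i + b))"

definition beta_total :: "real \<Rightarrow> real \<Rightarrow> real \<Rightarrow> real" where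
  "beta_total q a b = (\<Sum>i. beta_weight q a b i)"

definition beta_mean :: "real \<Rightarrow> real \<Rightarrow> real \<Rightarrow> (nat \<Rightarrow> real) \<Rightarrow> real" where
  "beta_mean q a b g = (\<Sum>i. beta_weight q a b i * g i) / beta_total q a b"

lemma Bseq_diff:
  fixes f g :: "nat \<Rightarrow> real"
  assumes "Bseq f" "Bseq g" shows "Bseq (\<lambda>i. f i - g i)"
proof -
  obtain K L where KL: "\<And>n. norm (f n) \<le> K" "\<And>n. norm (g n) \<le> L"
    using assms by (auto simp: Bseq_def)
  show ?thesis
    by (rule BseqI'[of _ "K + L"]) (rule order.trans[OF norm_triangle_ineq4 add_mono[OF KL]])
qed

context
  fixes q :: real
  assumes q0: "0 < q" and q1: "q < 1"
begin

lemma powr_lt_1: "a > 0 \<Longrightarrow> q powr a < 1"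
  using q0 q1 by (simp add: powr01_less_one)

lemma q_num_pos: "a > 0 \<Longrightarrow> q_num q a > 0"
  using powr_lt_1[of a] q1 by (simp add: q_num_def)

lemma q_num_mono: "a \<le> b \<Longrightarrow> q_num q a \<le> q_num q b"
  using q0 q1 by (auto simp: q_num_def intro!: divide_right_mono powr_mono')

lemma q_num_add: "q_num q (a + b) = q_num q a + q powr a * q_num q b"
  using q0 q1 by (simp add: q_num_def powr_add field_simps)

lemma q_num_nat: "q_num q (real k) = (1 - q ^ k) / (1 - q)"
  using q0 by (simp add: q_num_def powr_realpow)

lemma q_num_1: "q_num q 1 = 1"
  using q0 q1 by (simp add: q_num_def)

text \<open>
  The constant of the theorem may not depend on \<open>q\<close>; this bound is what removes \<open>q\<close>
  from the contributions of \<open>\<alpha>\<close> and \<open>\<beta>\<close> to it.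
\<close>

lemma q_num_le:
  assumes "a \<ge> 0" shows "q_num q a \<le> a + 1"
proof -
  define N where "N = nat \<lceil>a\<rceil>"
  have N: "a \<le> real N" "real N \<le> a + 1" using assms unfolding N_def by linarith+
  have "1 + real N * (q - 1) \<le> (1 + (q - 1)) ^ N"
    using q0 by (intro Bernoulli_inequality) auto
  hence "q_num q (real N) \<le> real N" using q1 by (simp add: q_num_nat field_simps)
  thus ?thesis using N q_num_mono[of a "real N"] by linarith
qed

lemma convergent_prod_q_poch: "convergent_prod (\<lambda>j. 1 - q ^ j * x)"
proof -
  have "summable (\<lambda>j. norm ((1 - q ^ j * x) - 1))"
    using q0 q1 by (simp add: abs_mult summable_mult2 summable_geometric)
  thus ?thesis
    using abs_convergent_prod_conv_summable abs_convergent_prod_imp_convergent_prod by blast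
qed

lemma power_mult_lt_1:
  assumes "x < 1" shows "q ^ j * x < 1"
proof (cases "x \<le> 0")
  case True
  have "q ^ j * x \<le> 0" using True q0 by (simp add: mult_nonneg_nonpos)
  thus ?thesis by simp
next
  case False
  have "q ^ j * x \<le> 1 * x" using False q0 q1 by (intro mult_right_mono power_le_one) auto
  thus ?thesis using assms by simp
qed

lemma q_poch_inf_pos:
  assumes "x < 1" shows "q_poch_inf q x > 0"
proof -
  have *: "1 - q ^ j * x > 0" for j
    using power_mult_lt_1[OF assms] by simp
  have "q_poch_inf q x \<ge> 0"
    unfolding q_poch_inf_def using *
    by (intro has_prod_nonneg[OF convergent_prod_has_prod[OF convergent_prod_q_poch]])
       (auto intro: less_imp_le)
  moreover have "q_poch_inf q x \<noteq> 0"
    unfolding q_poch_inf_def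
    using prodinf_nonzero[OF convergent_prod_q_poch, of x] * by (metis less_irrefl)
  ultimately show ?thesis by simp
qed

lemma q_poch_inf_step: "q_poch_inf q x = (1 - x) * q_poch_inf q (q * x)"
proof (cases "x = 1")
  case True
  have "(\<lambda>j. 1 - q ^ j * x) has_prod q_poch_inf q x"
    unfolding q_poch_inf_def by (rule convergent_prod_has_prod[OF convergent_prod_q_poch])
  moreover have "\<exists>i. 1 - q ^ i * x = 0" by (rule exI[of _ 0]) (simp add: True)
  ultimately have "q_poch_inf q x = 0" by (rule has_prod_zeroI[OF _ someI_ex])
  thus ?thesis by (simp add: True)
next
  case False
  have "prodinf (\<lambda>j. 1 - q ^ Suc j * x) = prodinf (\<lambda>j. 1 - q ^ j * x) / (1 - q ^ 0 * x)"
    using False by (intro prodinf_split_head convergent_prod_q_poch) auto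
  thus ?thesis using False by (simp add: q_poch_inf_def mult_ac)
qed

text \<open>
  Splitting $(1-x)_q^a$ into $(x;q)_\infty/(q^ax;q)_\infty$ reduces every identity between
  such powers to the functional equation of $(x;q)_\infty$. At \<open>x = 1\<close>, \<open>a = 0\<close> the
  quotient would be \<open>0 / 0\<close>.
\<close>

lemma q_pow_eq:
  assumes "a \<noteq> 0 \<or> x < 1"
  shows "q_pow q x a = q_poch_inf q x / q_poch_inf q (q powr a * x)"
proof (cases "a = 0")
  case True
  thus ?thesis using assms q_poch_inf_pos[of x] q0 by (simp add: q_pow_def)
next
  case False
  have "q_poch_inf q x / q_poch_inf q (q powr a * x)
      = (\<Prod>j. (1 - q ^ j * x) / (1 - q ^ j * (q powr a * x)))"
    unfolding q_poch_inf_def by (rule prodinf_divide[OF convergent_prod_q_poch convergent_prod_q_poch])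
  thus ?thesis using False q0 by (simp add: q_pow_def powr_add powr_realpow mult_ac)
qed

lemma q_poch_inf_split: "q_poch_inf q x = (\<Prod>j<m. 1 - q ^ j * x) * q_poch_inf q (q ^ m * x)"
proof (induction m)
  case (Suc m)
  thus ?case using q_poch_inf_step[of "q ^ m * x"] by (simp add: mult_ac)
qed simp

lemma q_pow_nat:
  assumes "x \<le> 1"
  shows "q_pow q x (real m) = (\<Prod>j<m. 1 - q ^ j * x)"
proof (cases "m = 0")
  case True thus ?thesis by (simp add: q_pow_def)
next
  case False
  have "q ^ m * x < 1"
  proof (cases "x < 1")
    case False
    thus ?thesis using assms q0 q1 \<open>m \<noteq> 0\<close> by (simp add: power_less_one_iff)
  qed (rule power_mult_lt_1)
  hence "q_poch_inf q (q ^ m * x) > 0" by (rule q_poch_inf_pos)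
  thus ?thesis
    using q_pow_eq[of "real m" x] False q_poch_inf_split[of x m] q0 by (simp add: powr_realpow)
qed

lemma beta_weight_pos:
  assumes "b > 0" shows "beta_weight q a b i > 0"
proof -
  have "q ^ Suc i < 1" using q0 q1 by (simp add: power_less_one_iff del: power_Suc)
  moreover have "q powr (real i + b) < 1" using assms by (intro powr_lt_1) auto
  ultimately show ?thesis using q0
    by (simp add: beta_weight_def q_poch_inf_pos del: power_Suc)
qed

lemma beta_weight_shift_a: "beta_weight q (a + 1) b i = q ^ i * beta_weight q a b i"
  using q0 by (simp add: beta_weight_def powr_add power_mult_distrib)

lemma q_poch_inf_powr_step:
  "q_poch_inf q (q powr (real i + b)) = (1 - q ^ i * q powr b) * q_poch_inf q (q powr (real (Suc i) + b))"
proof -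
  have "q powr (real (Suc i) + b) = q * (q ^ i * q powr b)"
    using q0 by (simp only: powr_add powr_realpow) simp
  moreover have "q powr (real i + b) = q ^ i * q powr b"
    using q0 by (simp only: powr_add powr_realpow)
  ultimately show ?thesis using q_poch_inf_step[of "q ^ i * q powr b"] by simp
qed

lemma power_powr_lt_1: "b > 0 \<Longrightarrow> q ^ i * q powr b < 1"
  using power_mult_lt_1 powr_lt_1 by blast

lemma beta_weight_shift_b:
  assumes "b > 0"
  shows "beta_weight q a (b + 1) i = (1 - q ^ i * q powr b) * beta_weight q a b i"
proof -
  have "real i + (b + 1) = real (Suc i) + b" by simp
  hence "beta_weight q a (b + 1) i = (q powr a) ^ i * q_poch_inf q (q ^ Suc i) / q_poch_inf q (q powr (real (Suc i) + b))"
    unfolding beta_weight_def by metis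
  thus ?thesis
    using q_poch_inf_powr_step[of i b] power_powr_lt_1[OF assms, of i]
    by (simp add: beta_weight_def del: power_Suc)
qed

text \<open>
  The discrete counterpart of $t(1-t)\cdot t^{a-1}(1-t)^{b-1}=t^{a}(1-t)^{b}$: the left-hand side is
  the boundary term of a summation by parts, and its shift is again a weight.
\<close>

lemma beta_weight_Suc:
  assumes "b > 0"
  shows "(1 - q ^ Suc i) * beta_weight q a b (Suc i) = q powr a * beta_weight q a (b + 1) i"
proof -
  have "real i + (b + 1) = real (Suc i) + b" by simp
  hence *: "beta_weight q a (b + 1) i
      = (q powr a) ^ i * q_poch_inf q (q ^ Suc i) / q_poch_inf q (q powr (real (Suc i) + b))"
    unfolding beta_weight_def by metis
  have "q_poch_inf q (q ^ Suc i) = (1 - q ^ Suc i) * q_poch_inf q (q ^ Suc (Suc i))"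
    using q_poch_inf_step[of "q ^ Suc i"] by simp
  thus ?thesis
    unfolding * unfolding beta_weight_def
    by (simp add: mult_ac del: of_nat_Suc)
qed

lemma beta_weight_ratio:
  assumes "b > 0"
  shows "beta_weight q a b (Suc i)
       = q powr a * ((1 - q ^ i * q powr b) / (1 - q ^ Suc i)) * beta_weight q a b i"
proof -
  have "q ^ Suc i < 1" using q0 q1 by (simp add: power_less_one_iff del: power_Suc)
  hence "beta_weight q a b (Suc i) = q powr a * beta_weight q a (b + 1) i / (1 - q ^ Suc i)"
    by (subst beta_weight_Suc[OF assms, symmetric]) simp
  thus ?thesis using beta_weight_shift_b[OF assms] by simp
qed

text \<open>
  Consecutive weights have a ratio tending to $q^a<1$.
\<close>

lemma summable_beta_weight:
  assumes "a > 0" "b > 0" shows "summable (beta_weight q a b)"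
proof -
  let ?r = "\<lambda>i. q powr a * ((1 - q ^ i * q powr b) / (1 - q ^ Suc i))"
  have "(\<lambda>i. q ^ i) \<longlonglongrightarrow> 0" using q0 q1 by (intro LIMSEQ_realpow_zero) auto
  hence "?r \<longlonglongrightarrow> q powr a * ((1 - 0 * q powr b) / (1 - q * 0))"
    unfolding power_Suc by (intro tendsto_mult tendsto_divide tendsto_diff tendsto_const) auto
  hence lim: "?r \<longlonglongrightarrow> q powr a" by simp
  \<comment> \<open>A bound \<open>c < 1\<close> strictly above the limit leaves room for finitely many exceptions.\<close>
  obtain c where c: "q powr a < c" "c < 1" using dense[OF powr_lt_1[OF assms(1)]] by blast
  obtain N where N: "\<And>n. n \<ge> N \<Longrightarrow> ?r n < c"
    using order_tendstoD(2)[OF lim c(1)] unfolding eventually_sequentially by blast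
  show ?thesis
  proof (rule summable_ratio_test[OF c(2)])
    fix n assume "n \<ge> N"
    have "beta_weight q a b (Suc n) \<le> c * beta_weight q a b n"
      using N[OF \<open>n \<ge> N\<close>] beta_weight_pos[OF assms(2)]
      unfolding beta_weight_ratio[OF assms(2)] by (intro mult_right_mono) (auto intro: less_imp_le)
    thus "norm (beta_weight q a b (Suc n)) \<le> c * norm (beta_weight q a b n)"
      using beta_weight_pos[OF assms(2)] by (simp add: abs_of_pos)
  qed
qed

lemma Bseq_qpow: "Bseq (\<lambda>i. q ^ i)" 
  using q0 q1 by (intro BseqI'[of _ 1]) (auto intro: power_le_one)

lemma summable_beta_weight_mult:
  assumes "a > 0" "b > 0" "Bseq g" shows "summable (\<lambda>i. beta_weight q a b i * g i)"
proof -
  obtain K where K: "\<And>n. norm (g n) \<le> K" using assms(3) by (auto simp: Bseq_def)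
  show ?thesis
  proof (rule summable_comparison_test')
    show "summable (\<lambda>i. K * beta_weight q a b i)"
      by (intro summable_mult summable_beta_weight assms)
    fix n :: nat
    show "norm (beta_weight q a b n * g n) \<le> K * beta_weight q a b n"
      using mult_left_mono[OF K[of n], of "beta_weight q a b n"] beta_weight_pos[OF assms(2), of a n]
      by (simp add: abs_mult mult.commute)
  qed
qed

lemma beta_total_pos: "a > 0 \<Longrightarrow> b > 0 \<Longrightarrow> beta_total q a b > 0"
  unfolding beta_total_def by (intro suminf_pos summable_beta_weight beta_weight_pos)

text \<open>
  Summation by parts against $G_i=(1-q^i)\,W_{a,b}(i)$. Both boundary terms vanish, at \<open>i = 0\<close>
  because of the factor $1-q^0$ and at infinity because the weights are summable. Applied to a
  constant it is the recurrence of the $q$-Beta function; applied to lattice samples of a function it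
  moves the difference quotient from the weights onto the function.
\<close>

lemma beta_abel_summation:
  assumes "a > 0" "b > 0" "Bseq g"
  shows "(\<Sum>i. beta_weight q a b i * ((1 - q powr (a + b)) * q ^ i - (1 - q powr a)) * g i)
       = q powr a * (\<Sum>i. beta_weight q a (b + 1) i * (g i - g (Suc i)))"
proof -
  define G where "G i = (1 - q ^ i) * beta_weight q a b i" for i
  have GS: "G (Suc i) = q powr a * beta_weight q a (b + 1) i" for i
    unfolding G_def by (rule beta_weight_Suc[OF assms(2)])
  have Gd: "G (Suc i) - G i
      = beta_weight q a b i * ((1 - q powr (a + b)) * q ^ i - (1 - q powr a))" for i
    unfolding GS beta_weight_shift_b[OF assms(2)] using q0
    by (simp add: G_def powr_add algebra_simps)
  have BG: "Bseq (\<lambda>i. (1 - q ^ i) * g i)" by (intro Bseq_mult Bseq_diff assms(3) Bseq_qpow) auto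
  \<comment> \<open>The increments of $G_ig_i$ sum to zero; what remains of them is the summation by parts.\<close>
  have tele: "(\<lambda>i. G (Suc i) * g (Suc i) - G i * g i) sums (0 - G 0 * g 0)"
  proof (rule telescope_sums)
    have "summable (\<lambda>i. G i * g i)"
      using summable_beta_weight_mult[OF assms(1,2) BG] by (simp add: G_def mult_ac)
    thus "(\<lambda>i. G i * g i) \<longlonglongrightarrow> 0" by (rule summable_LIMSEQ_zero)
  qed
  have B1: "Bseq (\<lambda>i. g i - g (Suc i))"
    using assms(3) by (intro Bseq_diff) (auto simp: Bseq_Suc_iff)
  have s1: "summable (\<lambda>i. beta_weight q a (b + 1) i * (g i - g (Suc i)))"
    using assms by (intro summable_beta_weight_mult B1) auto
  have "(\<lambda>i. (G (Suc i) * g (Suc i) - G i * g i) + q powr a * (beta_weight q a (b + 1) i * (g i - g (Suc i))))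
     sums ((0 - G 0 * g 0) + q powr a * (\<Sum>i. beta_weight q a (b + 1) i * (g i - g (Suc i))))"
    by (intro sums_add tele sums_mult summable_sums s1)
  moreover have "(G (Suc i) * g (Suc i) - G i * g i) + q powr a * (beta_weight q a (b + 1) i * (g i - g (Suc i)))
      = (G (Suc i) - G i) * g i" for i
    unfolding GS by (simp add: algebra_simps)
  moreover have "G 0 = 0" by (simp add: G_def)
  ultimately show ?thesis by (simp add: Gd sums_iff)
qed

lemma suminf_weight_mult_a: "(\<Sum>i. beta_weight q a b i * q ^ i) = beta_total q (a + 1) b"
  by (simp add: beta_total_def beta_weight_shift_a mult.commute)

lemma beta_total_shift_a:
  assumes "a > 0" "b > 0"
  shows "q_num q a * beta_total q a b = q_num q (a + b) * beta_total q (a + 1) b"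
proof -
  have s: "summable (\<lambda>i. beta_weight q a b i * q ^ i)" "summable (beta_weight q a b)"
    by (intro summable_beta_weight_mult summable_beta_weight assms Bseq_qpow)+
  have "0 = (\<Sum>i. beta_weight q a b i * ((1 - q powr (a + b)) * q ^ i - (1 - q powr a)))"
    using beta_abel_summation[OF assms Bfun_const[of 1]] by simp
  also have "\<dots> = (\<Sum>i. (1 - q powr (a + b)) * (beta_weight q a b i * q ^ i) - (1 - q powr a) * beta_weight q a b i)"
    by (simp add: algebra_simps)
  also have "\<dots> = (1 - q powr (a + b)) * beta_total q (a + 1) b - (1 - q powr a) * beta_total q a b"
    using s by (simp add: suminf_diff[symmetric] summable_mult suminf_mult suminf_weight_mult_a beta_total_def)
  finally show ?thesis by (simp add: q_num_def)
qed

lemma beta_total_shift_b: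
  assumes "a > 0" "b > 0"
  shows "q_num q (a + b) * beta_total q a (b + 1) = q_num q b * beta_total q a b"
proof -
  have s: "summable (\<lambda>i. beta_weight q a b i * q ^ i)" "summable (beta_weight q a b)"
    by (intro summable_beta_weight_mult summable_beta_weight assms Bseq_qpow)+
  have "beta_total q a (b + 1) = (\<Sum>i. beta_weight q a b i - q powr b * (beta_weight q a b i * q ^ i))"
    unfolding beta_total_def beta_weight_shift_b[OF assms(2)] by (simp add: algebra_simps)
  also have "\<dots> = beta_total q a b - q powr b * beta_total q (a + 1) b"
    using s by (simp add: suminf_diff[symmetric] summable_mult suminf_mult suminf_weight_mult_a beta_total_def)
  finally have *: "beta_total q a (b + 1) = beta_total q a b - q powr b * beta_total q (a + 1) b" .
  have "q_num q (a + b) * beta_total q a (b + 1)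
      = q_num q (a + b) * beta_total q a b - q powr b * (q_num q (a + b) * beta_total q (a + 1) b)"
    unfolding * by (simp add: algebra_simps)
  also have "\<dots> = (q_num q (a + b) - q powr b * q_num q a) * beta_total q a b"
    unfolding beta_total_shift_a[OF assms, symmetric] by (simp add: algebra_simps)
  also have "q_num q (a + b) - q powr b * q_num q a = q_num q b"
    using q_num_add[of b a] by (simp add: add.commute)
  finally show ?thesis .
qed

text \<open>
  The mechanism of the whole proof. The weights of the two means differ from $W_{a,b}$ by the factors
  $q^i$ and $1-q^{b+i}$, and after normalisation by the $q$-Beta recurrences their difference is
  proportional to the increment of $G_i=(1-q^i)W_{a,b}(i)$. Summation by parts then replaces the samples
  \<open>g\<close> by their difference quotients and raises both parameters by one.
\<close>

lemma beta_mean_diff: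
  assumes a: "a > 0" and b: "b > 0" and g: "Bseq g" and c: "Bseq c"
      and gc: "\<And>i. g i - g (Suc i) = \<kappa> * q ^ i * c i"
  shows "beta_mean q (a + 1) b g - beta_mean q a (b + 1) g
       = \<kappa> * q powr a / (1 - q powr (a + b + 1)) * beta_mean q (a + 1) (b + 1) c"
proof -
  define I where "I = beta_total q a (b + 1)"
  have I: "I > 0" unfolding I_def using a b by (intro beta_total_pos) auto
  have na: "q_num q a > 0" and nb: "q_num q b > 0" and nab: "q_num q (a + b) > 0"
    and nab1: "q_num q (a + b + 1) > 0"
    using a b by (auto intro!: q_num_pos)
  have nw: "1 - q powr a > 0" "1 - q powr (a + b + 1) > 0"
    using powr_lt_1[of a] powr_lt_1[of "a+b+1"] a b by auto
  \<comment> \<open>Both totals are expressed through the one of $W_{a,b+1}$, so that the two means get a common denominator.\<close>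
  have bt: "q_num q b * beta_total q (a + 1) b = q_num q a * I"
  proof -
    have "q_num q (a + b) * (q_num q b * beta_total q (a + 1) b) = q_num q b * (q_num q a * beta_total q a b)"
      using beta_total_shift_a[OF a b] by simp
    also have "\<dots> = q_num q (a + b) * (q_num q a * I)"
      unfolding I_def using beta_total_shift_b[OF a b] by simp
    finally show ?thesis using nab by simp
  qed
  hence bt': "beta_total q (a + 1) b = q_num q a * I / q_num q b" using nb by (simp add: field_simps)
  have B2: "Bseq (\<lambda>i. q ^ i * g i)" by (intro Bseq_mult Bseq_qpow g)
  have s1: "summable (\<lambda>i. beta_weight q a b i * (q ^ i * g i))"
    by (intro summable_beta_weight_mult a b B2)
  have s2: "summable (\<lambda>i. beta_weight q a b i * g i)"
    by (intro summable_beta_weight_mult a b g)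
  have e1: "(\<Sum>i. beta_weight q (a + 1) b i * g i) = (\<Sum>i. beta_weight q a b i * (q ^ i * g i))" (is "_ = ?X")
    by (simp add: beta_weight_shift_a mult_ac)
  have e2: "(\<Sum>i. beta_weight q a (b + 1) i * g i) = (\<Sum>i. beta_weight q a b i * g i) - q powr b * ?X"
    (is "_ = ?Y - _")
  proof -
    have "(\<Sum>i. beta_weight q a (b + 1) i * g i)
        = (\<Sum>i. beta_weight q a b i * g i - q powr b * (beta_weight q a b i * (q ^ i * g i)))"
      unfolding beta_weight_shift_b[OF b] by (simp add: algebra_simps)
    thus ?thesis using s1 s2 by (simp add: suminf_diff[symmetric] summable_mult suminf_mult)
  qed
  have e3: "(1 - q powr (a + b)) * ?X - (1 - q powr a) * ?Y
      = q powr a * (\<Sum>i. beta_weight q a (b + 1) i * (g i - g (Suc i)))"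
  proof -
    have "(1 - q powr (a + b)) * ?X - (1 - q powr a) * ?Y
      = (\<Sum>i. (1 - q powr (a + b)) * (beta_weight q a b i * (q ^ i * g i)) - (1 - q powr a) * (beta_weight q a b i * g i))"
      using s1 s2 by (simp add: suminf_diff[symmetric] summable_mult suminf_mult)
    also have "\<dots> = (\<Sum>i. beta_weight q a b i * ((1 - q powr (a + b)) * q ^ i - (1 - q powr a)) * g i)"
      by (simp add: algebra_simps)
    finally show ?thesis using beta_abel_summation[OF a b g] by simp
  qed
  have e4: "(\<Sum>i. beta_weight q a (b + 1) i * (g i - g (Suc i)))
     = \<kappa> * (\<Sum>i. beta_weight q (a + 1) (b + 1) i * c i)" (is "_ = _ * ?Z")
  proof -
    have "summable (\<lambda>i. beta_weight q (a + 1) (b + 1) i * c i)"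
      using a b by (intro summable_beta_weight_mult c) auto
    from suminf_mult[OF this, of \<kappa>] show ?thesis
      unfolding gc by (simp add: beta_weight_shift_a mult_ac)
  qed
  have bt2: "beta_total q (a + 1) (b + 1) = q_num q a * I / q_num q (a + b + 1)"
    using beta_total_shift_a[of a "b + 1"] a b nab1 by (simp add: I_def field_simps)
  have "beta_mean q (a + 1) b g - beta_mean q a (b + 1) g
      = q_num q b * ?X / (q_num q a * I) - (?Y - q powr b * ?X) / I"
    using I na nb by (simp add: beta_mean_def e1 e2 bt' I_def[symmetric])
  also have "\<dots> = ((q_num q b + q powr b * q_num q a) * ?X - q_num q a * ?Y) / (q_num q a * I)"
    using I na by (simp add: field_simps)
  also have "q_num q b + q powr b * q_num q a = q_num q (a + b)"
    using q_num_add[of b a] by (simp add: add.commute)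
  also have "(q_num q (a + b) * ?X - q_num q a * ?Y) / (q_num q a * I)
     = ((1 - q powr (a + b)) * ?X - (1 - q powr a) * ?Y) / ((1 - q powr a) * I)"
  proof -
    have *: "(u / d * X - v / d * Y) / (v / d * I) = (u * X - v * Y) / (v * I)"
      if "d \<noteq> 0" for u v d X Y :: real
    proof -
      have "u / d * X - v / d * Y = (u * X - v * Y) / d" by (simp add: diff_divide_distrib)
      thus ?thesis using that by simp
    qed
    show ?thesis unfolding q_num_def by (rule *) (use q1 in simp)
  qed
  also have "\<dots> = q powr a * \<kappa> * ?Z / ((1 - q powr a) * I)"
    unfolding e3 e4 by simp
  also have "\<dots> = \<kappa> * q powr a / (1 - q powr (a + b + 1)) * beta_mean q (a + 1) (b + 1) c"
  proof -
    have v: "1 - q powr s = (1 - q) * q_num q s" for s using q1 by (simp add: q_num_def)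
    show ?thesis unfolding beta_mean_def bt2 v using q1 I na nab1 by (simp add: mult_ac)
  qed
  finally show ?thesis .
qed

lemma beta_mean_mono:
  assumes "a > 0" "b > 0" "Bseq g" "Bseq h" "\<And>i. g i \<le> h i"
  shows "beta_mean q a b g \<le> beta_mean q a b h"
  unfolding beta_mean_def using assms beta_total_pos[of a b]
  by (intro divide_right_mono suminf_le summable_beta_weight_mult mult_left_mono)
     (auto intro: less_imp_le beta_weight_pos)

lemma beta_mean_lincomb:
  assumes "a > 0" "b > 0" "Bseq g" "Bseq h"
  shows "beta_mean q a b (\<lambda>i. u * g i + v * h i) = u * beta_mean q a b g + v * beta_mean q a b h"
proof -
  note s = summable_beta_weight_mult[OF assms(1,2,3)] summable_beta_weight_mult[OF assms(1,2,4)]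
  have "(\<Sum>i. beta_weight q a b i * (u * g i + v * h i))
     = (\<Sum>i. u * (beta_weight q a b i * g i) + v * (beta_weight q a b i * h i))"
    by (simp add: algebra_simps)
  also have "\<dots> = u * (\<Sum>i. beta_weight q a b i * g i) + v * (\<Sum>i. beta_weight q a b i * h i)"
    using s by (simp add: suminf_add[symmetric] summable_mult suminf_mult)
  finally show ?thesis by (simp add: beta_mean_def add_divide_distrib)
qed

lemma beta_mean_const:
  assumes "a > 0" "b > 0" shows "beta_mean q a b (\<lambda>i. c) = c"
  using beta_total_pos[OF assms] summable_beta_weight[OF assms]
  by (simp add: beta_mean_def beta_total_def suminf_mult2[symmetric])

lemma beta_mean_qpow:
  assumes "a > 0" "b > 0"
  shows "beta_mean q a b (\<lambda>i. q ^ i) = q_num q a / q_num q (a + b)"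
  using beta_total_shift_a[OF assms] beta_total_pos[OF assms] q_num_pos[of "a + b"] assms
  unfolding beta_mean_def suminf_weight_mult_a by (simp add: field_simps)

lemma beta_mean_qpow2:
  assumes "a > 0" "b > 0"
  shows "beta_mean q a b (\<lambda>i. (q ^ i)\<^sup>2)
       = q_num q a * q_num q (a + 1) / (q_num q (a + b) * q_num q (a + b + 1))"
proof -
  have "(\<Sum>i. beta_weight q a b i * (q ^ i)\<^sup>2) = (\<Sum>i. beta_weight q (a + 1) b i * q ^ i)"
    by (simp add: beta_weight_shift_a power2_eq_square mult_ac)
  also have "\<dots> = beta_total q (a + 1 + 1) b" by (rule suminf_weight_mult_a)
  also have "\<dots> = q_num q (a + 1) / q_num q (a + b + 1) * beta_total q (a + 1) b"
    using beta_total_shift_a[of "a + 1" b] assms q_num_pos[of "a + b + 1"] by (simp add: field_simps)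
  also have "\<dots> = q_num q (a + 1) / q_num q (a + b + 1) * (q_num q a / q_num q (a + b) * beta_total q a b)"
    using beta_total_shift_a[of a b] assms q_num_pos[of "a + b"] by (simp add: field_simps)
  finally show ?thesis using beta_total_pos[OF assms] by (simp add: beta_mean_def mult_ac)
qed

end

section \<open>The $q$-Bernstein basis\<close>

text \<open>
  The value of the $q$-Bernstein basis on $x\le1$, written with a finite product, so that it is a
  polynomial on the whole line; differentiability at \<open>0\<close> needs both sides of \<open>0\<close>.
\<close>

definition bernstein_poly :: "real \<Rightarrow> nat \<Rightarrow> nat \<Rightarrow> real \<Rightarrow> real" where
  "bernstein_poly q n k x = q_binomial q n k * x ^ k * (\<Prod>j<n - k. 1 - q ^ j * x)"

context
  fixes q :: real
  assumes q0: "0 < q" and q1: "q < 1"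
begin

lemma bernstein_poly_eq:
  assumes "k \<le> n" "x \<le> 1" shows "q_bernstein n k q x = bernstein_poly q n k x"
proof -
  have "real n - real k = real (n - k)" using assms by simp
  thus ?thesis using q_pow_nat[OF q0 q1 assms(2)]
    by (simp only: q_bernstein_def bernstein_poly_def)
qed

lemma q_fact_Suc: "q_fact q (Suc n) = q_fact q n * q_num q (real (Suc n))"
  by (simp add: q_fact_def)

lemma q_num_Suc_pos: "q_num q (real (Suc n)) > 0"
  using q_num_pos[OF q0 q1, of "real (Suc n)"] by simp

lemma q_fact_pos: "q_fact q n > 0"
  unfolding q_fact_def using q_num_pos[OF q0 q1] by (intro prod_pos) auto

lemma q_binomial_pos: "q_binomial q n k > 0"
  by (simp add: q_binomial_def q_fact_pos)

lemma q_binomial_n_0: "q_binomial q n 0 = 1" "q_binomial q n n = 1"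
proof -
  have "q_fact q 0 = 1" by (simp add: q_fact_def)
  thus "q_binomial q n 0 = 1" "q_binomial q n n = 1"
    using q_fact_pos[of n] by (simp_all add: q_binomial_def)
qed

lemma q_binomial_absorb:
  assumes "k \<le> m"
  shows "q_binomial q (Suc m) (Suc k) * q_num q (real (Suc k)) = q_num q (real (Suc m)) * q_binomial q m k"
  using q_num_Suc_pos[of k] q_fact_pos[of k] q_fact_pos[of "m-k"]
  by (simp add: q_binomial_def q_fact_Suc field_simps del: of_nat_Suc)

lemma q_binomial_absorb_comp:
  assumes "k \<le> m"
  shows "q_binomial q (Suc m) k * q_num q (real (Suc m - k)) = q_num q (real (Suc m)) * q_binomial q m k"
proof -
  have "Suc m - k = Suc (m - k)" using assms by simp
  thus ?thesis
  using q_num_Suc_pos[of "m-k"] q_fact_pos[of k] q_fact_pos[of "m-k"]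
  by (simp add: q_binomial_def q_fact_Suc field_simps del: of_nat_Suc)
qed

lemma q_binomial_pascal:
  assumes "k < n"
  shows "q_binomial q (Suc n) (Suc k) = q ^ (n - k) * q_binomial q n k + q_binomial q n (Suc k)"
proof -
  have "real (Suc n) = real (n - k) + real (Suc k)" using assms by simp
  hence "q_num q (real (Suc n)) = q_num q (real (n - k)) + q ^ (n - k) * q_num q (real (Suc k))"
    using q_num_add[OF q0 q1, of "real (n-k)" "real (Suc k)"] q0 by (simp only: powr_realpow)
  hence "q_num q (real (Suc n)) * q_binomial q (Suc n) (Suc k)
     = q_binomial q (Suc n) (Suc k) * q_num q (real (Suc n - Suc k)) + q ^ (n - k) * (q_binomial q (Suc n) (Suc k) * q_num q (real (Suc k)))"
    by (simp add: algebra_simps del: of_nat_Suc)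
  also have "\<dots> = q_num q (real (Suc n)) * (q ^ (n - k) * q_binomial q n k + q_binomial q n (Suc k))"
    using assms by (subst q_binomial_absorb, simp, subst q_binomial_absorb_comp) (auto simp: algebra_simps simp del: of_nat_Suc)
  finally show ?thesis using q_num_Suc_pos[of n] by simp
qed

lemma bernstein_poly_0: "bernstein_poly q (Suc n) 0 x = (1 - q ^ n * x) * bernstein_poly q n 0 x"
  by (simp add: bernstein_poly_def q_binomial_n_0)

lemma bernstein_poly_top: "bernstein_poly q (Suc n) (Suc n) x = x * bernstein_poly q n n x"
  by (simp add: bernstein_poly_def q_binomial_n_0)

text \<open>
  Together with the two boundary cases before it this is a Markov chain in the degree: from state
  \<open>k\<close> at time \<open>n\<close>, for \<open>x\<close> in the unit interval, the chain moves to \<open>k + 1\<close> with probability $q^{n-k}x$ and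
  stays otherwise.
\<close>

lemma bernstein_poly_Suc:
  assumes "k < n"
  shows "bernstein_poly q (Suc n) (Suc k) x
    = (1 - q ^ (n - Suc k) * x) * bernstein_poly q n (Suc k) x + q ^ (n - k) * x * bernstein_poly q n k x"
proof -
  define p where "p = n - Suc k"
  have p: "n - k = Suc p" "n - Suc k = p" using assms by (auto simp: p_def)
  show ?thesis unfolding bernstein_poly_def q_binomial_pascal[OF assms] diff_Suc_Suc p
    by (simp add: algebra_simps)
qed

text \<open>
  The expectation of \<open>\<phi>\<close> one step later. Since $[k+1]_q-[k]_q=q^k$, the jump probability
  $q^{n-k}x$ turns into $q^nx$, which does not depend on \<open>k\<close>; this is why the moments of $[k]_q$
  below follow by induction on the degree.
\<close>

lemma bernstein_sum_Suc:
  "(\<Sum>k\<le>Suc n. bernstein_poly q (Suc n) k x * \<phi> k)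
   = (\<Sum>k\<le>n. bernstein_poly q n k x * (\<phi> k + q ^ (n - k) * x * (\<phi> (Suc k) - \<phi> k)))"
proof -
  let ?b = "bernstein_poly q n"
  have "(\<Sum>k\<le>Suc n. bernstein_poly q (Suc n) k x * \<phi> k)
      = (1 - q ^ n * x) * ?b 0 x * \<phi> 0 + (\<Sum>k\<le>n. bernstein_poly q (Suc n) (Suc k) x * \<phi> (Suc k))"
    by (subst sum.atMost_Suc_shift) (simp add: bernstein_poly_0)
  also have "(\<Sum>k\<le>n. bernstein_poly q (Suc n) (Suc k) x * \<phi> (Suc k))
     = (\<Sum>k<n. bernstein_poly q (Suc n) (Suc k) x * \<phi> (Suc k)) + x * ?b n x * \<phi> (Suc n)"
    by (simp add: bernstein_poly_top flip: lessThan_Suc_atMost)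
  also have "(\<Sum>k<n. bernstein_poly q (Suc n) (Suc k) x * \<phi> (Suc k))
     = (\<Sum>k<n. (1 - q ^ (n - Suc k) * x) * ?b (Suc k) x * \<phi> (Suc k))
     + (\<Sum>k<n. q ^ (n - k) * x * ?b k x * \<phi> (Suc k))"
    by (subst sum.distrib[symmetric], intro sum.cong) (auto simp: bernstein_poly_Suc algebra_simps)
  finally have "(\<Sum>k\<le>Suc n. bernstein_poly q (Suc n) k x * \<phi> k)
     = ((1 - q ^ n * x) * ?b 0 x * \<phi> 0 + (\<Sum>k<n. (1 - q ^ (n - Suc k) * x) * ?b (Suc k) x * \<phi> (Suc k)))
     + ((\<Sum>k<n. q ^ (n - k) * x * ?b k x * \<phi> (Suc k)) + x * ?b n x * \<phi> (Suc n))" by simp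
  also have "(1 - q ^ n * x) * ?b 0 x * \<phi> 0 + (\<Sum>k<n. (1 - q ^ (n - Suc k) * x) * ?b (Suc k) x * \<phi> (Suc k))
     = (\<Sum>k<Suc n. (1 - q ^ (n - k) * x) * ?b k x * \<phi> k)"
    by (subst sum.lessThan_Suc_shift) simp
  also have "(\<Sum>k<n. q ^ (n - k) * x * ?b k x * \<phi> (Suc k)) + x * ?b n x * \<phi> (Suc n)
     = (\<Sum>k<Suc n. q ^ (n - k) * x * ?b k x * \<phi> (Suc k))" by simp
  finally show ?thesis
    unfolding sum.distrib[symmetric] lessThan_Suc_atMost by (simp add: algebra_simps)
qed

lemma bernstein_moment_0: "(\<Sum>k\<le>n. bernstein_poly q n k x) = 1"
proof (induction n)
  case 0
  thus ?case by (simp add: bernstein_poly_def q_binomial_n_0)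
next
  case (Suc n)
  thus ?case using bernstein_sum_Suc[of n x "\<lambda>_. 1"] by simp
qed

lemma q_num_Suc: "q_num q (real (Suc k)) = q_num q (real k) + q ^ k"
  using q0 q1 by (simp add: q_num_nat[OF q0 q1] field_simps del: of_nat_Suc)

lemma q_num_Suc': "q_num q (real (Suc k)) = 1 + q * q_num q (real k)"
  using q0 q1 by (simp add: q_num_nat[OF q0 q1] field_simps del: of_nat_Suc)

lemma bernstein_moment_1: "(\<Sum>k\<le>n. bernstein_poly q n k x * q_num q (real k)) = q_num q (real n) * x"
proof (induction n)
  case 0
  thus ?case by (simp add: q_num_def q0[THEN less_imp_neq, THEN not_sym])
next
  case (Suc n)
  have "(\<Sum>k\<le>Suc n. bernstein_poly q (Suc n) k x * q_num q (real k))
     = (\<Sum>k\<le>n. bernstein_poly q n k x * (q_num q (real k) + q ^ (n - k) * x * q ^ k))"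
    unfolding bernstein_sum_Suc q_num_Suc by simp
  also have "\<dots> = (\<Sum>k\<le>n. bernstein_poly q n k x * q_num q (real k) + q ^ n * x * bernstein_poly q n k x)"
  proof (intro sum.cong refl)
    fix k assume "k \<in> {..n}"
    hence "q ^ n = q ^ (n - k) * q ^ k" by (simp flip: power_add)
    thus "bernstein_poly q n k x * (q_num q (real k) + q ^ (n - k) * x * q ^ k)
       = bernstein_poly q n k x * q_num q (real k) + q ^ n * x * bernstein_poly q n k x"
      by (simp add: algebra_simps)
  qed
  also have "\<dots> = q_num q (real n) * x + q ^ n * x"
    by (simp add: sum.distrib Suc.IH sum_distrib_left[symmetric] bernstein_moment_0)
  finally show ?case unfolding q_num_Suc by (simp add: algebra_simps)
qed

lemma bernstein_moment_2: "(\<Sum>k\<le>n. bernstein_poly q n k x * (q_num q (real k))\<^sup>2)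
   = (q_num q (real n) * x)\<^sup>2 + q_num q (real n) * x * (1 - x)"
proof (induction n)
  case 0
  thus ?case by (simp add: q_num_def q0[THEN less_imp_neq, THEN not_sym])
next
  case (Suc n)
  let ?N = "q_num q (real n)"
  have d: "(q_num q (real (Suc k)))\<^sup>2 - (q_num q (real k))\<^sup>2 = q ^ k * (1 + (1 + q) * q_num q (real k))" for k
  proof -
    have "(q_num q (real (Suc k)))\<^sup>2 - (q_num q (real k))\<^sup>2
       = (q_num q (real (Suc k)) - q_num q (real k)) * (q_num q (real (Suc k)) + q_num q (real k))"
      by (simp add: power2_eq_square algebra_simps)
    also have "q_num q (real (Suc k)) - q_num q (real k) = q ^ k" unfolding q_num_Suc by simp
    also have "q_num q (real (Suc k)) + q_num q (real k) = 1 + (1 + q) * q_num q (real k)"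
      unfolding q_num_Suc' by (simp add: algebra_simps)
    finally show ?thesis .
  qed
  have qN: "q ^ n = 1 - (1 - q) * ?N" using q_num_Suc[of n] q_num_Suc'[of n] by (simp add: algebra_simps)
  have "(\<Sum>k\<le>Suc n. bernstein_poly q (Suc n) k x * (q_num q (real k))\<^sup>2)
     = (\<Sum>k\<le>n. bernstein_poly q n k x * ((q_num q (real k))\<^sup>2 + q ^ (n - k) * x * (q ^ k * (1 + (1 + q) * q_num q (real k)))))"
    unfolding bernstein_sum_Suc d by simp
  also have "\<dots> = (\<Sum>k\<le>n. bernstein_poly q n k x * (q_num q (real k))\<^sup>2
      + (q ^ n * x * bernstein_poly q n k x + q ^ n * x * (1 + q) * (bernstein_poly q n k x * q_num q (real k))))"
  proof (intro sum.cong refl)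
    fix k assume "k \<in> {..n}"
    hence "q ^ n = q ^ (n - k) * q ^ k" by (simp flip: power_add)
    thus "bernstein_poly q n k x * ((q_num q (real k))\<^sup>2 + q ^ (n - k) * x * (q ^ k * (1 + (1 + q) * q_num q (real k))))
      = bernstein_poly q n k x * (q_num q (real k))\<^sup>2
      + (q ^ n * x * bernstein_poly q n k x + q ^ n * x * (1 + q) * (bernstein_poly q n k x * q_num q (real k)))"
      by (simp add: algebra_simps)
  qed
  also have "\<dots> = (?N * x)\<^sup>2 + ?N * x * (1 - x) + (q ^ n * x + q ^ n * x * (1 + q) * (?N * x))"
    unfolding sum.distrib Suc.IH sum_distrib_left[symmetric] bernstein_moment_0 bernstein_moment_1 by simp
  finally show ?case unfolding q_num_Suc' qN
    by (simp add: power2_eq_square algebra_simps)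
qed

lemma bernstein_variance:
  "(\<Sum>k\<le>n. bernstein_poly q n k x * (q_num q (real k) - q_num q (real n) * x)\<^sup>2)
    = q_num q (real n) * x * (1 - x)"
proof -
  let ?N = "q_num q (real n)"
  have "(\<Sum>k\<le>n. bernstein_poly q n k x * (q_num q (real k) - ?N * x)\<^sup>2)
     = (\<Sum>k\<le>n. bernstein_poly q n k x * (q_num q (real k))\<^sup>2
       - 2 * ?N * x * (bernstein_poly q n k x * q_num q (real k)) + (?N * x)\<^sup>2 * bernstein_poly q n k x)"
    by (simp add: power2_eq_square algebra_simps)
  also have "\<dots> = (?N * x)\<^sup>2 + ?N * x * (1 - x) - 2 * ?N * x * (?N * x) + (?N * x)\<^sup>2 * 1"
    unfolding sum.distrib sum_subtractf sum_distrib_left[symmetric]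
      bernstein_moment_0 bernstein_moment_1 bernstein_moment_2 by simp
  finally show ?thesis by (simp add: power2_eq_square algebra_simps)
qed

lemma bernstein_poly_nonneg:
  assumes "0 \<le> x" "x \<le> 1" shows "bernstein_poly q n k x \<ge> 0"
  unfolding bernstein_poly_def using assms q0 q1 q_binomial_pos[of n k]
  by (intro mult_nonneg_nonneg prod_nonneg) (auto intro!: mult_le_one power_le_one)

text \<open>
  The $q$-analogue of the rule that the derivative of a Bernstein polynomial is the Bernstein
  polynomial of one degree less formed with the differences of the coefficients. Stated without
  division by \<open>x\<close>, it is an identity of polynomials that is used on both sides of \<open>0\<close>.
\<close>

lemma bernstein_q_diff:
  fixes c :: "nat \<Rightarrow> real" and m :: nat
  defines "H \<equiv> \<lambda>x. \<Sum>k\<le>Suc m. c k * bernstein_poly q (Suc m) k x"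
  shows "H (q * x) - H x = (q - 1) * x * (q_num q (real (Suc m)) *
      (\<Sum>k\<le>m. (c (Suc k) - c k) / q ^ k * bernstein_poly q m k (q * x)))"
proof -
  \<comment> \<open>Dividing by $q^k$ cancels the power that $(qx)^k$ brings in; in these polynomials the difference of
    one basis element is a plain difference of two neighbours.\<close>
  define e where "e k = bernstein_poly q m k (q * x) / q ^ k" for k
  define S where "S p = (\<Prod>j<p. 1 - q ^ j * (q * x))" for p
  let ?n = "q_num q (real (Suc m))"
  let ?d = "\<lambda>k. bernstein_poly q (Suc m) k (q * x) - bernstein_poly q (Suc m) k x"
  have e: "e k = q_binomial q m k * x ^ k * S (m - k)" for k
    using q0 by (simp add: e_def S_def bernstein_poly_def power_mult_distrib)
  have S1: "(\<Prod>j<Suc p. 1 - q ^ j * (q * x)) = S p * (1 - q ^ Suc p * x)" for p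
    by (simp add: S_def mult_ac)
  have S2: "(\<Prod>j<Suc p. 1 - q ^ j * x) = (1 - x) * S p" for p
    unfolding S_def by (subst prod.lessThan_Suc_shift) (simp add: mult_ac)
  have nq: "(q - 1) * q_num q (real j) = q ^ j - 1" for j
    using q1 by (simp add: q_num_nat[OF q0 q1] field_simps)
  have d0: "?d 0 = (q - 1) * x * ?n * (0 - e 0)"
  proof -
    have "?d 0 = S m * ((1 - q ^ Suc m * x) - (1 - x))"
      by (simp only: bernstein_poly_def q_binomial_n_0 diff_zero S1 S2) (simp add: algebra_simps)
    also have "\<dots> = ((q - 1) * ?n) * x * (0 - e 0)"
      unfolding nq e by (simp add: q_binomial_n_0 algebra_simps)
    finally show ?thesis by (simp only: mult_ac)
  qed
  have dtop: "?d (Suc m) = (q - 1) * x * ?n * (e m - 0)"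
  proof -
    have "?d (Suc m) = (q ^ Suc m - 1) * x ^ Suc m"
      by (simp add: bernstein_poly_def q_binomial_n_0 power_mult_distrib algebra_simps)
    also have "\<dots> = ((q - 1) * ?n) * x * (e m - 0)"
      unfolding nq e by (simp add: q_binomial_n_0 S_def)
    finally show ?thesis by (simp only: mult_ac)
  qed
  have dk: "?d (Suc k) = (q - 1) * x * ?n * (e k - e (Suc k))" if "k < m" for k
  proof -
    define p where "p = m - Suc k"
    have p: "m - k = Suc p" "m - Suc k = p" "Suc m - Suc k = Suc p" using that by (auto simp: p_def)
    have m: "q ^ Suc k * q ^ Suc p = q ^ Suc m" using that by (simp add: p_def flip: power_add power_Suc)
    let ?C = "q_binomial q (Suc m) (Suc k)"
    have "?d (Suc k) = ?C * x ^ Suc k * S p * (q ^ Suc k * (1 - q ^ Suc p * x) - (1 - x))"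
      unfolding bernstein_poly_def p S1 S2 power_mult_distrib by (simp add: algebra_simps)
    also have "\<dots> = ?C * x ^ Suc k * S p * ((q ^ Suc k - 1) * (1 - q ^ Suc p * x) - x * (q ^ Suc p - 1))"
      by (simp add: algebra_simps)
    also have "\<dots> = (q - 1) * x * ((?C * q_num q (real (Suc k))) * x ^ k * (S p * (1 - q ^ Suc p * x))
                           - (?C * q_num q (real (Suc m - Suc k))) * x ^ Suc k * S p)"
      unfolding nq[symmetric] p by (simp add: algebra_simps del: of_nat_Suc)
    also have "\<dots> = (q - 1) * x * ((?n * q_binomial q m k) * x ^ k * (S p * (1 - q ^ Suc p * x))
                           - (?n * q_binomial q m (Suc k)) * x ^ Suc k * S p)"
      using that by (subst q_binomial_absorb, simp, subst q_binomial_absorb_comp) simp_all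
    also have "\<dots> = (q - 1) * x * ?n * (e k - e (Suc k))"
      unfolding e p S1[unfolded S_def[symmetric]] by (simp add: algebra_simps del: of_nat_Suc)
    finally show ?thesis .
  qed
  have "H (q * x) - H x = (\<Sum>k\<le>Suc m. c k * ?d k)"
    unfolding H_def by (simp only: sum_subtractf[symmetric] right_diff_distrib)
  also have "\<dots> = c 0 * ?d 0 + ((\<Sum>k<m. c (Suc k) * ?d (Suc k)) + c (Suc m) * ?d (Suc m))"
    by (subst sum.atMost_Suc_shift)
       (simp only: lessThan_Suc_atMost[symmetric] sum.lessThan_Suc add.assoc)
  also have "\<dots> = (q - 1) * x * ?n * ((\<Sum>k<m. c (Suc k) * e k) + c (Suc m) * e m
         - (c 0 * e 0 + (\<Sum>k<m. c (Suc k) * e (Suc k))))"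
  proof -
    have "(\<Sum>k<m. c (Suc k) * ?d (Suc k)) = (q - 1) * x * ?n * ((\<Sum>k<m. c (Suc k) * e k) - (\<Sum>k<m. c (Suc k) * e (Suc k)))"
      unfolding sum_subtractf[symmetric] sum_distrib_left
      by (intro sum.cong refl) (subst dk, auto simp: algebra_simps)
    thus ?thesis unfolding d0 dtop by (simp add: algebra_simps)
  qed
  also have "c 0 * e 0 + (\<Sum>k<m. c (Suc k) * e (Suc k)) = (\<Sum>k<Suc m. c k * e k)"
    by (subst sum.lessThan_Suc_shift) simp
  also have "(\<Sum>k<m. c (Suc k) * e k) + c (Suc m) * e m = (\<Sum>k<Suc m. c (Suc k) * e k)" by simp
  finally show ?thesis
    unfolding sum_subtractf[symmetric] lessThan_Suc_atMost e_def
    by (simp add: algebra_simps diff_divide_distrib)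
qed

text \<open>
  At \<open>x = 0\<close> the $q$-derivative is the ordinary derivative. Dividing the polynomial identity by
  \<open>x\<close> and letting \<open>x\<close> tend to \<open>0\<close> gives $(q-1)H'(0)$ on one side and the value of
  a continuous function at \<open>0\<close> on the other.
\<close>

lemma bernstein_q_deriv:
  fixes c :: "nat \<Rightarrow> real" and m :: nat
  defines "H \<equiv> \<lambda>x. \<Sum>k\<le>Suc m. c k * bernstein_poly q (Suc m) k x"
  assumes h: "\<And>x. x \<le> 1 \<Longrightarrow> h x = H x" and x: "x \<le> 1" "0 \<le> x"
  shows "q_deriv q h x = q_num q (real (Suc m)) *
      (\<Sum>k\<le>m. (c (Suc k) - c k) / q ^ k * bernstein_poly q m k (q * x))"
proof -
  define R where "R x = q_num q (real (Suc m)) *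
      (\<Sum>k\<le>m. (c (Suc k) - c k) / q ^ k * bernstein_poly q m k (q * x))" for x
  have HR: "H (q * x) - H x = (q - 1) * x * R x" for x
    unfolding H_def R_def by (rule bernstein_q_diff)
  show ?thesis
  proof (cases "x = 0")
    case False
    have "q * x \<le> 1" using x q0 q1 by (intro mult_le_one) auto
    hence "q_deriv q h x = (H (q * x) - H x) / ((q - 1) * x)"
      using False x by (simp add: q_deriv_def h)
    thus ?thesis using False q1 by (simp add: HR R_def)
  next
    case True
    have "(\<lambda>x. \<Prod>j<p. 1 - q ^ j * x) differentiable at 0" for p
      by (induction p) auto
    hence "H differentiable (at 0)"
      unfolding H_def bernstein_poly_def by (auto intro!: derivative_intros)
    then obtain D where D: "(H has_real_derivative D) (at 0)"
      by (auto simp: real_differentiable_def)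
    have qD: "((\<lambda>x. H (q * x)) has_real_derivative D * q) (at 0)"
      using DERIV_chain2[of H D "\<lambda>x. q * x" 0 q] D by (auto intro!: derivative_eq_intros)
    have "((\<lambda>x. H (q * x) - H x) has_real_derivative (q - 1) * D) (at 0)"
      using DERIV_diff[OF qD D] by (simp add: algebra_simps)
    hence "((\<lambda>x. (q - 1) * x * R x) has_real_derivative (q - 1) * D) (at 0)" by (simp add: HR)
    hence l1: "((\<lambda>x. (q - 1) * R x) \<longlongrightarrow> (q - 1) * D) (at 0)"
      unfolding has_field_derivative_iff
      by (rule Lim_transform_eventually) (auto simp: eventually_at_filter)
    have "isCont R 0" unfolding R_def bernstein_poly_def using q0 by (intro continuous_intros) auto
    hence l2: "((\<lambda>x. (q - 1) * R x) \<longlongrightarrow> (q - 1) * R 0) (at 0)"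
      by (intro tendsto_intros) (simp add: isCont_def)
    have "D = R 0" using tendsto_unique[OF _ l1 l2] q1 by simp
    moreover have "deriv h 0 = deriv H 0"
    proof (rule deriv_cong_ev)
      have "eventually (\<lambda>x::real. x < 1) (nhds 0)" 
        using eventually_nhds_in_open[of "{..<1::real}" 0] by (simp add: open_lessThan)
      thus "eventually (\<lambda>x. h x = H x) (nhds 0)" by eventually_elim (simp add: h)
    qed simp
    moreover have "deriv H 0 = D" using D by (rule DERIV_imp_deriv)
    ultimately show ?thesis using True by (simp add: q_deriv_def R_def)
  qed
qed

end

section \<open>Uniform norm and modulus of continuity on the unit interval\<close>

lemma continuous_on_unit_bounded:
  fixes g :: "real \<Rightarrow> real"
  assumes "continuous_on {0..1} g"
  obtains K where "\<And>x. x \<in> {0..1} \<Longrightarrow> \<bar>g x\<bar> \<le> K"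
proof -
  have "bounded (g ` {0..1})"
    by (intro compact_imp_bounded compact_continuous_image assms) auto
  then obtain K where "\<forall>x\<in>{0..1}. \<bar>g x\<bar> \<le> K" by (auto simp: bounded_iff)
  thus ?thesis using that by blast
qed

lemma unif_norm_upper:
  assumes "continuous_on {0..1} g" "x \<in> {0..1}" shows "\<bar>g x\<bar> \<le> unif_norm g"
proof -
  obtain K where "\<And>x. x \<in> {0..1} \<Longrightarrow> \<bar>g x\<bar> \<le> K"
    using continuous_on_unit_bounded[OF assms(1)] by metis
  hence "bdd_above ((\<lambda>x. \<bar>g x\<bar>) ` {0..1})" by (intro bdd_aboveI2)
  thus ?thesis unfolding unif_norm_def by (rule cSUP_upper[OF assms(2)])
qed

lemma modulus_bdd:
  fixes g :: "real \<Rightarrow> real"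
  assumes "continuous_on {0..1} g"
  shows "bdd_above {\<bar>g x - g y\<bar> | x y. x \<in> {0..1} \<and> y \<in> {0..1} \<and> \<bar>x - y\<bar> \<le> \<delta>}"
proof -
  obtain B where B: "\<And>x. x \<in> {0..1} \<Longrightarrow> \<bar>g x\<bar> \<le> B"
    using continuous_on_unit_bounded[OF assms] by metis
  show ?thesis
  proof (rule bdd_aboveI[of _ "2 * B"], clarify)
    fix x y :: real assume "x \<in> {0..1}" "y \<in> {0..1}"
    thus "\<bar>g x - g y\<bar> \<le> 2 * B" using B[of x] B[of y] by linarith
  qed
qed

lemma modulus_ge:
  assumes "continuous_on {0..1} g" "x \<in> {0..1}" "y \<in> {0..1}" "\<bar>x - y\<bar> \<le> \<delta>"
  shows "\<bar>g x - g y\<bar> \<le> modulus_of_continuity g \<delta>"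
  unfolding modulus_of_continuity_def
  by (rule cSup_upper[OF _ modulus_bdd[OF assms(1)]]) (use assms in blast)

lemma modulus_nonneg:
  assumes "continuous_on {0..1} g" "\<delta> \<ge> 0" shows "modulus_of_continuity g \<delta> \<ge> 0"
  using modulus_ge[OF assms(1), of 0 0 \<delta>] assms(2) by simp

text \<open>
  The segment from \<open>x\<close> to \<open>y\<close> is cut into \<open>N\<close> equal pieces.
\<close>

lemma modulus_steps:
  assumes "continuous_on {0..1} g" "x \<in> {0..1}" "y \<in> {0..1}" "\<bar>x - y\<bar> \<le> real N * \<delta>"
  shows "\<bar>g x - g y\<bar> \<le> real N * modulus_of_continuity g \<delta>"
  using assms(2-4)
proof (induction N arbitrary: y)
  case 0
  thus ?case by simp
next
  case (Suc N)
  define w where "w = real N / real (Suc N)"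
  define z where "z = (1 - w) * x + w * y"
  have w: "0 \<le> w" "w \<le> 1" "1 - w = 1 / real (Suc N)" by (simp_all add: w_def field_simps)
  have "z \<in> {0..1}"
    using convexD[of "{0..1::real}" x y "1 - w" w] Suc.prems w(1,2) unfolding z_def by simp
  have h: "\<bar>x - y\<bar> / real (Suc N) \<le> \<delta>" using Suc.prems(3) by (simp add: field_simps)
  have "x - z = w * (x - y)" by (simp add: z_def algebra_simps)
  hence "\<bar>x - z\<bar> = real N * (\<bar>x - y\<bar> / real (Suc N))" by (simp add: abs_mult w_def)
  also have "\<dots> \<le> real N * \<delta>" using h by (intro mult_left_mono) auto
  finally have 1: "\<bar>g x - g z\<bar> \<le> real N * modulus_of_continuity g \<delta>"
    by (intro Suc.IH \<open>z \<in> {0..1}\<close> Suc.prems)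
  have "z - y = (1 - w) * (x - y)" by (simp add: z_def algebra_simps)
  hence "\<bar>z - y\<bar> = \<bar>x - y\<bar> / real (Suc N)" unfolding w(3) by (simp add: abs_mult)
  hence 2: "\<bar>g z - g y\<bar> \<le> modulus_of_continuity g \<delta>"
    using h by (intro modulus_ge assms(1) \<open>z \<in> {0..1}\<close> Suc.prems) simp
  show ?case using 1 2 by (simp add: algebra_simps)
qed

text \<open>
  Pointwise control of \<open>g\<close> by a quadratic, so that applying a positive operator leaves only its
  second moment to be estimated.
\<close>

lemma modulus_quadratic:
  assumes "continuous_on {0..1} g" "x \<in> {0..1}" "y \<in> {0..1}" "\<delta> > 0"
  shows "\<bar>g x - g y\<bar> \<le> modulus_of_continuity g \<delta> * (1 + (x - y)\<^sup>2 / \<delta>\<^sup>2)"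
proof -
  let ?w = "modulus_of_continuity g \<delta>"
  have w: "?w \<ge> 0" using assms by (intro modulus_nonneg) auto
  define t where "t = \<bar>x - y\<bar> / \<delta>"
  have t: "t \<ge> 0" "\<bar>x - y\<bar> = t * \<delta>" using assms by (auto simp: t_def)
  have t2: "(x - y)\<^sup>2 / \<delta>\<^sup>2 = t\<^sup>2" by (simp add: t_def power_divide)
  show ?thesis
  proof (cases "t \<le> 1")
    case True
    hence "\<bar>g x - g y\<bar> \<le> ?w * 1" unfolding mult_1_right
      using t assms by (intro modulus_ge) auto
    also have "\<dots> \<le> ?w * (1 + (x - y)\<^sup>2 / \<delta>\<^sup>2)" using w by (intro mult_left_mono) auto
    finally show ?thesis .
  next
    case False
    define N where "N = nat \<lceil>t\<rceil>"
    have N: "t \<le> real N" "real N \<le> 1 + t" using t unfolding N_def by linarith+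
    have "\<bar>g x - g y\<bar> \<le> real N * ?w"
      using N t assms by (intro modulus_steps) (auto intro: mult_right_mono)
    also have "\<dots> \<le> (1 + t\<^sup>2) * ?w"
    proof (intro mult_right_mono w)
      have "t * 1 \<le> t * t" using False by (intro mult_left_mono) auto
      thus "real N \<le> 1 + t\<^sup>2" using N by (simp add: power2_eq_square)
    qed
    finally show ?thesis by (simp add: t2 mult.commute)
  qed
qed

lemma modulus_tendsto_0:
  assumes "continuous_on {0..1} g" "d \<longlonglongrightarrow> 0" "\<And>n. d n \<ge> 0"
  shows "(\<lambda>n. modulus_of_continuity g (d n)) \<longlonglongrightarrow> 0"
proof (rule tendstoI)
  fix e :: real assume e: "e > 0"
  have "uniformly_continuous_on {0..1} g"
    by (rule compact_uniformly_continuous[OF assms(1)]) auto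
  then obtain r where r: "r > 0"
    "\<And>x y. x \<in> {0..1} \<Longrightarrow> y \<in> {0..1} \<Longrightarrow> dist y x < r \<Longrightarrow> dist (g y) (g x) < e / 2"
    unfolding uniformly_continuous_on_def using half_gt_zero[OF e] by meson
  have "eventually (\<lambda>n. d n < r) sequentially" using assms(2) r(1) by (rule order_tendstoD)
  thus "eventually (\<lambda>n. dist (modulus_of_continuity g (d n)) 0 < e) sequentially"
  proof eventually_elim
    case (elim n)
    have "modulus_of_continuity g (d n) \<le> e / 2"
      unfolding modulus_of_continuity_def
    proof (rule cSup_least)
      show "{\<bar>g x - g y\<bar> |x y. x \<in> {0..1} \<and> y \<in> {0..1} \<and> \<bar>x - y\<bar> \<le> d n} \<noteq> {}"
        using assms(3)[of n] by (auto intro!: exI[of _ 0])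
      fix z assume "z \<in> {\<bar>g x - g y\<bar> |x y. x \<in> {0..1} \<and> y \<in> {0..1} \<and> \<bar>x - y\<bar> \<le> d n}"
      thus "z \<le> e / 2" using elim r(2) by (force simp: dist_real_def intro: less_imp_le)
    qed
    thus ?case using modulus_nonneg[OF assms(1,3), of n] e by (simp add: dist_real_def)
  qed
qed

section \<open>The Durrmeyer operator on lattice samples\<close>

text \<open>
  The Durrmeyer operator of degree \<open>m\<close> with parameters \<open>A\<close>, \<open>B\<close> evaluated at
  \<open>y\<close>, as a positive functional of the sequence of samples that a function takes at the nodes
  $q^{B+1+i}$. Sequences take the place of functions because it
  is applied to mean values $f'(\xi_i)$ whose points $\xi_i$ lie off the nodes.
\<close>

definition durrmeyer_mean ::
    "real \<Rightarrow> real \<Rightarrow> real \<Rightarrow> nat \<Rightarrow> real \<Rightarrow> (nat \<Rightarrow> real) \<Rightarrow> real" where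
  "durrmeyer_mean q A B m y h =
     (\<Sum>k\<le>m. bernstein_poly q m k y * beta_mean q (real k + A + 1) (real (m - k) + B + 1) h)"

context
  fixes q :: real
  assumes q0: "0 < q" and q1: "q < 1"
begin

lemma q_durrmeyer_coeff_eq:
  assumes "k \<le> n" "\<alpha> > -1" "\<beta> > -1"
  shows "q_durrmeyer_coeff \<alpha> \<beta> n k q f
    = beta_mean q (real k + \<alpha> + 1) (real (n - k) + \<beta> + 1) (\<lambda>i. f (q powr (\<beta> + 1) * q ^ i))"
proof -
  let ?a = "real k + \<alpha> + 1" and ?b = "real (n - k) + \<beta> + 1"
  have W: "q ^ i * ((q ^ i) powr (real k + \<alpha>) * q_pow q (q * q ^ i) (real n - real k + \<beta>))
      = beta_weight q ?a ?b i" for i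
  proof -
    have "q ^ Suc i < 1" using q0 q1 by (simp add: power_less_one_iff del: power_Suc)
    hence "q_pow q (q ^ Suc i) (real n - real k + \<beta>)
        = q_poch_inf q (q ^ Suc i) / q_poch_inf q (q powr (real n - real k + \<beta>) * q ^ Suc i)"
      by (intro q_pow_eq q0 q1) simp
    also have "q ^ Suc i = q powr (real (Suc i))" using q0 by (simp add: powr_realpow del: power_Suc of_nat_Suc)
    also have "q powr (real n - real k + \<beta>) * q powr (real (Suc i)) = q powr (real i + ?b)"
      using assms by (simp add: powr_add[symmetric] algebra_simps)
    also have "q powr (real (Suc i)) = q ^ Suc i" using q0 by (simp add: powr_realpow del: power_Suc of_nat_Suc)
    finally have 1: "q_pow q (q * q ^ i) (real n - real k + \<beta>) = q_poch_inf q (q ^ Suc i) / q_poch_inf q (q powr (real i + ?b))"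
      by simp
    have "(q ^ i) powr (real k + \<alpha>) = (q powr (real k + \<alpha>)) ^ i"
      using q0 by (simp add: powr_realpow[symmetric] powr_powr mult.commute)
    hence "q ^ i * (q ^ i) powr (real k + \<alpha>) = (q powr ?a) ^ i"
      using q0 by (simp add: powr_add power_mult_distrib mult_ac)
    thus ?thesis unfolding 1 beta_weight_def by (simp add: mult_ac)
  qed
  have "q_durrmeyer_coeff \<alpha> \<beta> n k q f
    = ((1 - q) * (\<Sum>i. beta_weight q ?a ?b i * f (q powr (\<beta> + 1) * q ^ i)))
      / ((1 - q) * (\<Sum>i. beta_weight q ?a ?b i))"
    unfolding q_durrmeyer_coeff_def jackson_integral_def W[symmetric] by (simp add: mult_ac)
  thus ?thesis using q1 by (simp add: beta_mean_def beta_total_def)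
qed

text \<open>
  The mean of the squared deviation is variance plus squared bias. The first two moments of $q^i$
  come from the $q$-Beta recurrence, and with $P=[a]_q$, $N=[a+b]_q$, $N'=1+qN$ the variance of $q^i$ is
  $P(N-P)/(N^2N')\le 1/N$.
\<close>

lemma beta_mean_sq_dev:
  assumes ab: "a > 0" "b > 0" and r: "0 \<le> r" "r \<le> 1"
  shows "beta_mean q a b (\<lambda>i. (r * q ^ i - y)\<^sup>2)
     \<le> 1 / q_num q (a + b) + (r * (q_num q a / q_num q (a + b)) - y)\<^sup>2"
proof -
  define P N N' where "P = q_num q a" and "N = q_num q (a + b)" and "N' = q_num q (a + b + 1)"
  have P: "P > 0" and N: "N > 0" and PN: "P \<le> N" and NN: "N \<le> N'"
    unfolding P_def N_def N'_def using ab by (auto intro!: q_num_pos q_num_mono q0 q1)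
  have P': "q_num q (a + 1) = 1 + q * P"
    using q_num_add[OF q0 q1, of 1 a] q0 by (simp add: P_def q_num_1[OF q0 q1] add.commute)
  have N': "N' = 1 + q * N"
    using q_num_add[OF q0 q1, of 1 "a + b"] q0 by (simp add: N'_def N_def q_num_1[OF q0 q1] add_ac)
  note B = Bseq_qpow[OF q0 q1]
  have B2: "Bseq (\<lambda>i. (q ^ i)\<^sup>2)" unfolding power2_eq_square by (intro Bseq_mult B)
  have B3: "Bseq (\<lambda>i. (- 2 * r * y) * q ^ i + y\<^sup>2 * 1)"
    by (subst Bseq_add_iff) (intro Bseq_mult B Bfun_const)
  have "beta_mean q a b (\<lambda>i. (r * q ^ i - y)\<^sup>2)
      = beta_mean q a b (\<lambda>i. r\<^sup>2 * (q ^ i)\<^sup>2 + 1 * ((- 2 * r * y) * q ^ i + y\<^sup>2 * 1))"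
    by (simp add: power2_eq_square algebra_simps)
  also have "\<dots> = r\<^sup>2 * beta_mean q a b (\<lambda>i. (q ^ i)\<^sup>2)
       + 1 * ((- 2 * r * y) * beta_mean q a b (\<lambda>i. q ^ i) + y\<^sup>2 * beta_mean q a b (\<lambda>i. 1))"
    by (subst beta_mean_lincomb[OF q0 q1 ab B2 B3], subst beta_mean_lincomb[OF q0 q1 ab B Bfun_const]) simp
  also have "\<dots> = r\<^sup>2 * (P * (1 + q * P) / (N * N')) - 2 * r * y * (P / N) + y\<^sup>2"
    using ab by (simp add: beta_mean_qpow2[OF q0 q1] beta_mean_qpow[OF q0 q1] beta_mean_const[OF q0 q1]
       P' flip: P_def N_def N'_def)
  also have "P * (1 + q * P) / (N * N') = P * (N - P) / (N\<^sup>2 * N') + (P / N)\<^sup>2"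
  proof -
    have "P * (N - P) / (N\<^sup>2 * N') + (P / N)\<^sup>2 = (P * (N - P) + P\<^sup>2 * N') / (N\<^sup>2 * N')"
      using N NN by (simp add: field_simps power2_eq_square)
    also have "P * (N - P) + P\<^sup>2 * N' = N * (P * (1 + q * P))"
      unfolding N' by (simp add: power2_eq_square algebra_simps)
    also have "\<dots> / (N\<^sup>2 * N') = P * (1 + q * P) / (N * N')"
      using N by (simp add: power2_eq_square)
    finally show ?thesis ..
  qed
  also have "r\<^sup>2 * (P * (N - P) / (N\<^sup>2 * N') + (P / N)\<^sup>2) - 2 * r * y * (P / N) + y\<^sup>2
     = r\<^sup>2 * (P * (N - P) / (N\<^sup>2 * N')) + (r * (P / N) - y)\<^sup>2"
    by (simp add: power2_eq_square algebra_simps)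
  also have "r\<^sup>2 * (P * (N - P) / (N\<^sup>2 * N')) \<le> 1 * (1 / N)"
  proof (rule mult_mono)
    show "r\<^sup>2 \<le> 1" using r by (simp add: power_le_one)
    have "P * (N - P) \<le> N * N" using P PN by (intro mult_mono) auto
    hence "P * (N - P) / (N\<^sup>2 * N') \<le> N\<^sup>2 / (N\<^sup>2 * N')"
      using N NN by (intro divide_right_mono) (auto simp: power2_eq_square)
    also have "\<dots> = 1 / N'" using N by simp
    also have "\<dots> \<le> 1 / N" using N NN by (intro divide_left_mono) auto
    finally show "P * (N - P) / (N\<^sup>2 * N') \<le> 1 / N" .
    show "0 \<le> P * (N - P) / (N\<^sup>2 * N')" using P N PN NN by (intro divide_nonneg_nonneg mult_nonneg_nonneg) auto
  qed auto
  finally show ?thesis by (simp add: P_def N_def)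
qed

lemma durrmeyer_mean_mono:
  assumes "A > -1" "B > -1" "0 \<le> y" "y \<le> 1" "Bseq g" "Bseq h" "\<And>i. g i \<le> h i"
  shows "durrmeyer_mean q A B m y g \<le> durrmeyer_mean q A B m y h"
  unfolding durrmeyer_mean_def using assms
  by (intro sum_mono mult_left_mono beta_mean_mono bernstein_poly_nonneg q0 q1) auto

lemma durrmeyer_mean_lincomb:
  assumes "A > -1" "B > -1" "Bseq g" "Bseq h"
  shows "durrmeyer_mean q A B m y (\<lambda>i. u * g i + v * h i)
    = u * durrmeyer_mean q A B m y g + v * durrmeyer_mean q A B m y h"
proof -
  have "beta_mean q (real k + A + 1) (real (m - k) + B + 1) (\<lambda>i. u * g i + v * h i)
     = u * beta_mean q (real k + A + 1) (real (m - k) + B + 1) g + v * beta_mean q (real k + A + 1) (real (m - k) + B + 1) h" for k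
    using assms by (intro beta_mean_lincomb q0 q1) auto
  thus ?thesis unfolding durrmeyer_mean_def
    by (simp add: sum_distrib_left sum.distrib algebra_simps del: of_nat_diff)
qed

lemma durrmeyer_mean_const:
  assumes "A > -1" "B > -1"
  shows "durrmeyer_mean q A B m y (\<lambda>i. c) = c"
proof -
  have "beta_mean q (real k + A + 1) (real (m - k) + B + 1) (\<lambda>i. c) = c" for k
    using assms by (intro beta_mean_const q0 q1) auto
  thus ?thesis
    by (simp add: durrmeyer_mean_def bernstein_moment_0[OF q0 q1] del: of_nat_diff flip: sum_distrib_right)
qed

text \<open>
  The bias of the \<open>k\<close>-th mean splits into $q^{A+B+2}([k]_q-[m]_qy)/N$ with
  $N=[m+A+B+2]_q$, whose square averages to at most $1/N$ by the variance of the $q$-Bernstein basis, and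
  into two terms of size $O(1/N)$ from the parameters. All constants are uniform in \<open>q\<close>.
\<close>

lemma durrmeyer_mean_sq_dev:
  assumes AB: "A \<ge> 0" "B \<ge> 0" and y: "0 \<le> y" "y \<le> 1"
  shows "durrmeyer_mean q A B m y (\<lambda>i. (q powr (B + 1) * q ^ i - y)\<^sup>2)
    \<le> (4 + 3 * ((A + 2)\<^sup>2 + (A + B + 3)\<^sup>2)) / q_num q (real (Suc m))"
proof -
  define r c1 c2 S N where "r = q powr (B + 1)" and "c1 = q_num q (A + 1)"
    and "c2 = q_num q (A + B + 2)" and "S = q_num q (real m)" and "N = q_num q (real m + A + B + 2)"
  define p where "p = q powr (A + B + 2)"
  have r: "0 \<le> r" "r \<le> 1" and p: "0 \<le> p" "p \<le> 1"
    unfolding r_def p_def using powr_lt_1[OF q0 q1, of "B+1"] powr_lt_1[OF q0 q1, of "A+B+2"] AB by auto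
  have N1: "1 \<le> N" unfolding N_def
    using q_num_mono[OF q0 q1, of 1 "real m + A + B + 2"] AB q_num_1[OF q0 q1] by simp
  have SN: "S \<le> N" unfolding S_def N_def using AB by (intro q_num_mono q0 q1) auto
  have S0: "0 \<le> S" unfolding S_def
    using q_num_mono[OF q0 q1, of 0 "real m"] q0 by (simp add: q_num_def)
  have sN: "q_num q (real (Suc m)) \<le> N" unfolding N_def using AB by (intro q_num_mono q0 q1) auto
  have c: "0 \<le> c1" "c1 \<le> A + 2" "0 \<le> c2" "c2 \<le> A + B + 3"
    unfolding c1_def c2_def using AB q_num_le[OF q0 q1, of "A+1"] q_num_le[OF q0 q1, of "A+B+2"]
    by (auto intro!: less_imp_le[OF q_num_pos[OF q0 q1]])
  have NS: "N = c2 + p * S"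
    using q_num_add[OF q0 q1, of "A + B + 2" "real m"] by (simp add: N_def c2_def p_def S_def add_ac)
  define s where "s k = q_num q (real k)" for k :: nat
  have each: "beta_mean q (real k + A + 1) (real (m - k) + B + 1) (\<lambda>i. (r * q ^ i - y)\<^sup>2)
      \<le> (1 / N + 3 * (c1\<^sup>2 + c2\<^sup>2) / N) + 3 / N\<^sup>2 * (s k - S * y)\<^sup>2" if k: "k \<le> m" for k
  proof -
    have ab: "real k + A + 1 + (real (m - k) + B + 1) = real m + A + B + 2" using k by simp
    have P: "q_num q (real k + A + 1) = c1 + q powr (A + 1) * s k"
      using q_num_add[OF q0 q1, of "A + 1" "real k"] by (simp add: c1_def s_def add_ac)
    have rp: "r * q powr (A + 1) = p" by (simp add: r_def p_def powr_add[symmetric] add_ac)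
    have "r * (q_num q (real k + A + 1) / N) - y = (r * (c1 + q powr (A + 1) * s k) - y * N) / N"
      unfolding P using N1 by (simp add: field_simps)
    also have "r * (c1 + q powr (A + 1) * s k) - y * N = r * c1 - y * c2 + p * (s k - S * y)"
      unfolding NS rp[symmetric] by (simp add: algebra_simps)
    finally have "(r * (q_num q (real k + A + 1) / N) - y)\<^sup>2 = (r * c1 - y * c2 + p * (s k - S * y))\<^sup>2 / N\<^sup>2"
      by (simp add: power_divide)
    also have "\<dots> \<le> (3 * (c1\<^sup>2 + c2\<^sup>2) + 3 * (s k - S * y)\<^sup>2) / N\<^sup>2"
    proof (intro divide_right_mono)
      have sq3: "(u - v + w)\<^sup>2 \<le> 3 * (u\<^sup>2 + v\<^sup>2) + 3 * w\<^sup>2" for u v w :: real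
        using zero_le_power2[of "u + v"] zero_le_power2[of "u - w"] zero_le_power2[of "v + w"]
        by (simp add: power2_eq_square algebra_simps)
      have le: "(t * z)\<^sup>2 \<le> z\<^sup>2" if "0 \<le> t" "t \<le> 1" for t z :: real
        using that mult_right_mono[of "t\<^sup>2" 1 "z\<^sup>2"] by (simp add: power_mult_distrib power_le_one)
      show "(r * c1 - y * c2 + p * (s k - S * y))\<^sup>2 \<le> 3 * (c1\<^sup>2 + c2\<^sup>2) + 3 * (s k - S * y)\<^sup>2"
        by (rule order.trans[OF sq3]) (intro add_mono mult_left_mono le r y p; simp)
    qed simp
    also have "\<dots> = 3 * (c1\<^sup>2 + c2\<^sup>2) / N\<^sup>2 + 3 / N\<^sup>2 * (s k - S * y)\<^sup>2"
      by (simp add: add_divide_distrib)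
    also have "3 * (c1\<^sup>2 + c2\<^sup>2) / N\<^sup>2 \<le> 3 * (c1\<^sup>2 + c2\<^sup>2) / N"
      using N1 by (intro divide_left_mono) (auto simp: power2_eq_square)
    finally have *: "(r * (q_num q (real k + A + 1) / N) - y)\<^sup>2
       \<le> 3 * (c1\<^sup>2 + c2\<^sup>2) / N + 3 / N\<^sup>2 * (s k - S * y)\<^sup>2" by simp
    have "beta_mean q (real k + A + 1) (real (m - k) + B + 1) (\<lambda>i. (r * q ^ i - y)\<^sup>2)
       \<le> 1 / N + (r * (q_num q (real k + A + 1) / N) - y)\<^sup>2"
      using beta_mean_sq_dev[of "real k + A + 1" "real (m - k) + B + 1" r y] AB r
      unfolding ab N_def by simp
    thus ?thesis using * by linarith
  qed
  have "durrmeyer_mean q A B m y (\<lambda>i. (r * q ^ i - y)\<^sup>2)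
     \<le> (\<Sum>k\<le>m. bernstein_poly q m k y * ((1 / N + 3 * (c1\<^sup>2 + c2\<^sup>2) / N) + 3 / N\<^sup>2 * (s k - S * y)\<^sup>2))"
    unfolding durrmeyer_mean_def
    using each y by (intro sum_mono mult_left_mono bernstein_poly_nonneg q0 q1) auto
  also have "\<dots> = (\<Sum>k\<le>m. (1 / N + 3 * (c1\<^sup>2 + c2\<^sup>2) / N) * bernstein_poly q m k y
        + 3 / N\<^sup>2 * (bernstein_poly q m k y * (s k - S * y)\<^sup>2))"
    by (simp only: distrib_left mult_ac)
  also have "\<dots> = (1 / N + 3 * (c1\<^sup>2 + c2\<^sup>2) / N) + 3 / N\<^sup>2 * (S * y * (1 - y))"
    unfolding sum.distrib sum_distrib_left[symmetric] bernstein_moment_0[OF q0 q1]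
      bernstein_variance[OF q0 q1] s_def S_def by simp
  also have "3 / N\<^sup>2 * (S * y * (1 - y)) \<le> 3 / N\<^sup>2 * N"
  proof (intro mult_left_mono)
    have "S * (y * (1 - y)) \<le> N * 1" using SN S0 N1 y by (intro mult_mono mult_le_one) auto
    thus "S * y * (1 - y) \<le> N" by (simp add: mult_ac)
  qed auto
  also have "(1 / N + 3 * (c1\<^sup>2 + c2\<^sup>2) / N) + 3 / N\<^sup>2 * N = (4 + 3 * (c1\<^sup>2 + c2\<^sup>2)) / N"
    using N1 by (simp add: field_simps power2_eq_square)
  also have "\<dots> \<le> (4 + 3 * ((A + 2)\<^sup>2 + (A + B + 3)\<^sup>2)) / N"
    using N1 c by (intro divide_right_mono add_left_mono mult_left_mono add_mono power_mono) auto
  also have "\<dots> \<le> (4 + 3 * ((A + 2)\<^sup>2 + (A + B + 3)\<^sup>2)) / q_num q (real (Suc m))"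
    using sN q_num_Suc_pos[OF q0 q1, of m] by (intro divide_left_mono) (auto intro!: add_nonneg_nonneg)
  finally show ?thesis by (simp add: r_def)
qed

section \<open>The $q$-derivative of the operator and its error\<close>

text \<open>
  The difference quotient of \<open>f\<close> over two consecutive nodes is a value of \<open>f'\<close> between
  them.
\<close>

lemma C1_mean_values:
  assumes "C1_with_deriv f f'" "\<beta> > -1"
  obtains \<xi> where "\<And>i. q powr (\<beta> + 2) * q ^ i < \<xi> i" "\<And>i. \<xi> i < q powr (\<beta> + 1) * q ^ i"
    "\<And>i. f (q powr (\<beta> + 1) * q ^ i) - f (q powr (\<beta> + 1) * q ^ Suc i)
        = (1 - q) * q powr (\<beta> + 1) * q ^ i * f' (\<xi> i)"
proof -
  define u where "u i = q powr (\<beta> + 1) * q ^ i" for i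
  have u: "0 < u i" "u i \<le> 1" "u (Suc i) < u i" for i
    using power_powr_lt_1[OF q0 q1, of "\<beta> + 1" i] assms(2) q0 q1 by (auto simp: u_def mult.commute)
  have "\<exists>x. u (Suc i) < x \<and> x < u i \<and> f (u i) - f (u (Suc i)) = (u i - u (Suc i)) * f' x" for i
  proof -
    have "\<exists>x\<in>{u (Suc i)<..<u i}. f (u i) - f (u (Suc i)) = (\<lambda>h. f' x * h) (u i - u (Suc i))"
    proof (rule mvt_simple[OF u(3)])
      fix x assume x: "u (Suc i) \<le> x" "x \<le> u i"
      hence "x \<in> {0..1}" using u(1)[of "Suc i"] u(2)[of i] by auto
      hence "(f has_real_derivative f' x) (at x within {0..1})"
        using assms(1) by (simp add: C1_with_deriv_def)
      moreover have "{u (Suc i)..u i} \<subseteq> {0..1}" using u(1)[of "Suc i"] u(2)[of i] by auto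
      ultimately have "(f has_real_derivative f' x) (at x within {u (Suc i)..u i})"
        by (rule has_field_derivative_subset)
      thus "(f has_derivative (\<lambda>h. f' x * h)) (at x within {u (Suc i)..u i})"
        by (simp add: has_field_derivative_def)
    qed
    thus ?thesis by (auto simp: mult.commute)
  qed
  then obtain \<xi> where \<xi>: "\<And>i. u (Suc i) < \<xi> i" "\<And>i. \<xi> i < u i"
     "\<And>i. f (u i) - f (u (Suc i)) = (u i - u (Suc i)) * f' (\<xi> i)" by metis
  have "q powr (\<beta> + 2) = q powr (\<beta> + 1 + 1)" by (rule arg_cong) simp
  also have "\<dots> = q powr (\<beta> + 1) * q" using q0 by (subst powr_add) simp
  finally have 2: "q powr (\<beta> + 2) * q ^ i = u (Suc i)" for i by (simp add: u_def)
  show ?thesis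
    by (rule that[of \<xi>]) (use \<xi> in \<open>auto simp: 2 simp flip: u_def\<close>, simp add: u_def algebra_simps)
qed

text \<open>
  The intertwining relation: the $q$-derivative of the operator is, up to a scalar, the operator with
  both parameters raised and the degree lowered, applied to difference quotients and evaluated at
  $qx$. The powers $q^k$ from the $q$-Bernstein differences cancel those from the Jackson means.
\<close>

lemma q_deriv_q_durrmeyer:
  assumes ab: "\<alpha> > -1" "\<beta> > -1" and x: "0 \<le> x" "x \<le> 1"
    and Bf: "Bseq (\<lambda>i. f (q powr (\<beta> + 1) * q ^ i))" and c: "Bseq c"
    and fc: "\<And>i. f (q powr (\<beta> + 1) * q ^ i) - f (q powr (\<beta> + 1) * q ^ Suc i)
        = (1 - q) * q powr (\<beta> + 1) * q ^ i * c i"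
  shows "q_deriv q (q_durrmeyer \<alpha> \<beta> (Suc m) q f) x
     = q powr (\<alpha> + \<beta> + 2) * q_num q (real (Suc m)) / q_num q (real (Suc m) + \<alpha> + \<beta> + 2)
        * durrmeyer_mean q (\<alpha> + 1) (\<beta> + 1) m (q * x) c"
proof -
  define g where "g i = f (q powr (\<beta> + 1) * q ^ i)" for i
  define C where "C k = beta_mean q (real k + \<alpha> + 1) (real (Suc m - k) + \<beta> + 1) g" for k
  let ?M = "q_num q (real (Suc m) + \<alpha> + \<beta> + 2)"
  have "q_deriv q (q_durrmeyer \<alpha> \<beta> (Suc m) q f) x = q_num q (real (Suc m)) *
      (\<Sum>k\<le>m. (C (Suc k) - C k) / q ^ k * bernstein_poly q m k (q * x))"
  proof (rule bernstein_q_deriv[OF q0 q1 _ x(2,1)])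
    fix x :: real assume "x \<le> 1"
    thus "q_durrmeyer \<alpha> \<beta> (Suc m) q f x = (\<Sum>k\<le>Suc m. C k * bernstein_poly q (Suc m) k x)"
      unfolding q_durrmeyer_def atLeast0AtMost
      by (intro sum.cong refl)
         (simp add: q_durrmeyer_coeff_eq ab bernstein_poly_eq[OF q0 q1] C_def g_def[abs_def])
  qed
  also have "\<dots> = q_num q (real (Suc m)) * (\<Sum>k\<le>m. q powr (\<alpha> + \<beta> + 2) / ?M *
      (bernstein_poly q m k (q * x) * beta_mean q (real k + (\<alpha> + 1) + 1) (real (m - k) + (\<beta> + 1) + 1) c))"
  proof (rule arg_cong2[of _ _ _ _ "(*)", OF refl], rule sum.cong[OF refl])
    fix k assume "k \<in> {..m}"
    hence k: "k \<le> m" by simp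
    let ?a = "real k + \<alpha> + 1" and ?b = "real (m - k) + \<beta> + 1"
    have e: "real (Suc k) + \<alpha> + 1 = ?a + 1" "real (Suc m - Suc k) + \<beta> + 1 = ?b"
      "real (Suc m - k) + \<beta> + 1 = ?b + 1" "?a + ?b + 1 = real (Suc m) + \<alpha> + \<beta> + 2"
      using k by (auto simp: Suc_diff_le)
    have "C (Suc k) - C k = beta_mean q (?a + 1) ?b g - beta_mean q ?a (?b + 1) g"
      unfolding C_def e ..
    also have "\<dots> = (1 - q) * q powr (\<beta> + 1) * q powr ?a / (1 - q powr (?a + ?b + 1))
        * beta_mean q (?a + 1) (?b + 1) c"
      using ab fc Bf by (intro beta_mean_diff q0 q1 c) (auto simp: g_def[abs_def])
    also have "q powr (\<beta> + 1) * q powr ?a = q powr (\<alpha> + \<beta> + 2) * q ^ k"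
      using q0 by (simp add: powr_realpow[symmetric] powr_add[symmetric] add_ac)
    hence "(1 - q) * q powr (\<beta> + 1) * q powr ?a / (1 - q powr (?a + ?b + 1))
      = q powr (\<alpha> + \<beta> + 2) * q ^ k / ?M"
      unfolding e q_num_def using q1 by (simp add: mult.assoc)
    finally have "(C (Suc k) - C k) / q ^ k = q powr (\<alpha> + \<beta> + 2) / ?M * beta_mean q (?a + 1) (?b + 1) c"
      using q0 by simp
    moreover have "?a + 1 = real k + (\<alpha> + 1) + 1" "?b + 1 = real (m - k) + (\<beta> + 1) + 1" by simp_all
    ultimately show "(C (Suc k) - C k) / q ^ k * bernstein_poly q m k (q * x)
      = q powr (\<alpha> + \<beta> + 2) / ?M * (bernstein_poly q m k (q * x) *
          beta_mean q (real k + (\<alpha> + 1) + 1) (real (m - k) + (\<beta> + 1) + 1) c)"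
      by (simp only: mult_ac)
  qed
  finally show ?thesis unfolding durrmeyer_mean_def sum_distrib_left[symmetric] by simp
qed

text \<open>
  Write the $q$-derivative as $\lambda\,L(f'(\xi_i))$ with the positive functional \<open>L\<close> at $y=qx$. Passing
  from $\xi_i$ to the node $v_i$ and from \<open>y\<close> to \<open>x\<close> costs $\omega(f',1-q)$ each, passing from $v_i$ to
  \<open>y\<close> costs a quadratic whose mean is bounded by the second moment estimate. The remaining factor
  satisfies $1-\lambda=[\alpha+\beta+2]_q/[n+\alpha+\beta+2]_q$, which produces the last summand.
\<close>

lemma q_deriv_q_durrmeyer_error:
  assumes ab: "\<alpha> > -1" "\<beta> > -1" and n: "n \<ge> 1" and f: "C1_with_deriv f f'" and x: "x \<in> {0..1}"
  shows "\<bar>q_deriv q (q_durrmeyer \<alpha> \<beta> n q f) x - f' x\<bar>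
    \<le> (5 + 3 * ((\<alpha> + 3)\<^sup>2 + (\<alpha> + \<beta> + 5)\<^sup>2)) * (modulus_of_continuity f' (1 / sqrt (q_num q (real n)))
                   + modulus_of_continuity f' (1 - q))
       + q_num q (\<alpha> + \<beta> + 2) / q_num q (real n) * unif_norm f'"
proof -
  obtain m where m: "n = Suc m" using n by (cases n) auto
  have cf': "continuous_on {0..1} f'" using f by (simp add: C1_with_deriv_def)
  have cf: "continuous_on {0..1} f"
    using f by (auto simp: C1_with_deriv_def intro!: DERIV_continuous_on)
  obtain K where K: "\<And>z. z \<in> {0..1} \<Longrightarrow> \<bar>f z\<bar> \<le> K"
    using continuous_on_unit_bounded[OF cf] by metis
  obtain K' where K': "\<And>z. z \<in> {0..1} \<Longrightarrow> \<bar>f' z\<bar> \<le> K'"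
    using continuous_on_unit_bounded[OF cf'] by metis
  obtain \<xi> where \<xi>: "\<And>i. q powr (\<beta> + 2) * q ^ i < \<xi> i" "\<And>i. \<xi> i < q powr (\<beta> + 1) * q ^ i"
    "\<And>i. f (q powr (\<beta> + 1) * q ^ i) - f (q powr (\<beta> + 1) * q ^ Suc i)
        = (1 - q) * q powr (\<beta> + 1) * q ^ i * f' (\<xi> i)"
    using C1_mean_values[OF f ab(2)] by blast
  define v where "v i = q powr (\<beta> + 2) * q ^ i" for i
  have u1: "q powr (\<beta> + 1) * q ^ i < 1" "0 < q powr (\<beta> + 1) * q ^ i" for i
    using power_powr_lt_1[OF q0 q1, of "\<beta> + 1" i] ab q0 by (simp_all add: mult.commute)
  have v1: "0 < v i" for i using q0 by (simp add: v_def)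
  have vx: "0 < v i" "v i < \<xi> i" "\<xi> i < 1" "\<xi> i - v i \<le> 1 - q" for i
  proof -
    have "q powr (\<beta> + 2) = q powr (\<beta> + 1 + 1)" by (rule arg_cong) simp
    also have "\<dots> = q powr (\<beta> + 1) * q" using q0 by (subst powr_add) simp
    finally have "\<xi> i - v i \<le> (1 - q) * (q powr (\<beta> + 1) * q ^ i)"
      using \<xi>(2)[of i] by (simp add: v_def algebra_simps)
    also have "\<dots> \<le> (1 - q) * 1" using u1[of i] q1 by (intro mult_left_mono) auto
    finally show "\<xi> i - v i \<le> 1 - q" by simp
    show "0 < v i" "v i < \<xi> i" "\<xi> i < 1" using v1[of i] \<xi>(1,2)[of i] u1[of i] by (auto simp: v_def)
  qed
  define c where "c i = f' (\<xi> i)" for i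
  have in01: "v i \<in> {0..1}" "\<xi> i \<in> {0..1}" for i using vx[of i] by auto
  have Bc: "Bseq c" by (rule BseqI'[of _ K']) (use K' in01 in \<open>auto simp: c_def\<close>)
  have Bg: "Bseq (\<lambda>i. f (q powr (\<beta> + 1) * q ^ i))"
  proof (rule BseqI'[of _ K])
    fix i
    show "norm (f (q powr (\<beta> + 1) * q ^ i)) \<le> K"
      using K[of "q powr (\<beta> + 1) * q ^ i"] u1[of i] by simp
  qed
  define y where "y = q * x"
  have y: "0 \<le> y" "y \<le> 1" "\<bar>y - x\<bar> \<le> 1 - q"
  proof -
    show "0 \<le> y" "y \<le> 1" using x q0 q1 by (auto simp: y_def intro: mult_le_one)
    have "y - x = - ((1 - q) * x)" by (simp add: y_def algebra_simps)
    hence "\<bar>y - x\<bar> = (1 - q) * x" using x q1 by (simp add: abs_mult)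
    also have "\<dots> \<le> (1 - q) * 1" using x q1 by (intro mult_left_mono) auto
    finally show "\<bar>y - x\<bar> \<le> 1 - q" by simp
  qed
  define n' N where "n' = q_num q (real n)" and "N = q_num q (real n + \<alpha> + \<beta> + 2)"
  have n': "n' > 0" "n' \<le> N"
    unfolding n'_def N_def using n ab by (auto intro!: q_num_pos q_num_mono q0 q1)
  define \<delta> where "\<delta> = 1 / sqrt n'"
  have \<delta>: "\<delta> > 0" "\<delta>\<^sup>2 = 1 / n'" using n' by (auto simp: \<delta>_def power_divide)
  define w1 w2 where "w1 = modulus_of_continuity f' (1 - q)" and "w2 = modulus_of_continuity f' \<delta>"
  have w: "w1 \<ge> 0" "w2 \<ge> 0" unfolding w1_def w2_def using q1 \<delta> by (auto intro!: modulus_nonneg cf')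
  let ?L = "durrmeyer_mean q (\<alpha> + 1) (\<beta> + 1) m y"
  \<comment> \<open>The majorant: $\omega(f',1-q)$ twice and the quadratic bound with $1/\delta^2=[n]_q$.\<close>
  define h where "h i = (2 * w1 + w2) * 1 + w2 * n' * (v i - y)\<^sup>2" for i
  have AB: "\<alpha> + 1 > -1" "\<beta> + 1 > -1" using ab by auto
  have Bsq: "Bseq (\<lambda>i. (v i - y)\<^sup>2)"
  proof (rule BseqI'[of _ 1])
    fix i
    have "\<bar>v i - y\<bar> \<le> 1" using in01[of i] y by auto
    thus "norm ((v i - y)\<^sup>2) \<le> 1" by (simp add: abs_square_le_1)
  qed
  have Bh: "Bseq h" unfolding h_def using Bseq_mult[OF Bfun_const Bsq, of "w2 * n'"]
    by (subst add.commute) (simp add: Bseq_add_iff)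
  have ch: "\<bar>c i - f' x\<bar> \<le> h i" for i
  proof -
    have "\<bar>f' (\<xi> i) - f' (v i)\<bar> \<le> w1" unfolding w1_def
      using vx[of i] in01 by (intro modulus_ge cf') auto
    moreover have "\<bar>f' (v i) - f' y\<bar> \<le> w2 * (1 + (v i - y)\<^sup>2 / \<delta>\<^sup>2)" unfolding w2_def
      using y in01 \<delta> by (intro modulus_quadratic cf') auto
    moreover have "\<bar>f' y - f' x\<bar> \<le> w1" unfolding w1_def
      using y x by (intro modulus_ge cf') auto
    ultimately show ?thesis unfolding h_def c_def \<delta>(2) by (simp add: algebra_simps)
  qed
  have Lh: "?L h \<le> 2 * w1 + w2 + w2 * (4 + 3 * ((\<alpha> + 3)\<^sup>2 + (\<alpha> + \<beta> + 5)\<^sup>2))"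
  proof -
    have "?L h = (2 * w1 + w2) * ?L (\<lambda>i. 1) + w2 * n' * ?L (\<lambda>i. (v i - y)\<^sup>2)"
      unfolding h_def by (rule durrmeyer_mean_lincomb[OF AB Bfun_const Bsq])
    also have "?L (\<lambda>i. 1) = 1" by (rule durrmeyer_mean_const[OF AB])
    also have "?L (\<lambda>i. (v i - y)\<^sup>2) \<le> (4 + 3 * ((\<alpha> + 3)\<^sup>2 + (\<alpha> + \<beta> + 5)\<^sup>2)) / n'"
    proof -
      have e: "\<beta> + 1 + 1 = \<beta> + 2" "\<alpha> + 1 + 2 = \<alpha> + 3" "\<alpha> + 1 + (\<beta> + 1) + 3 = \<alpha> + \<beta> + 5" by simp_all
      show ?thesis
        using durrmeyer_mean_sq_dev[of "\<alpha> + 1" "\<beta> + 1" y m] ab y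
        unfolding e v_def n'_def m by simp
    qed
    hence "w2 * n' * ?L (\<lambda>i. (v i - y)\<^sup>2) \<le> w2 * n' * ((4 + 3 * ((\<alpha> + 3)\<^sup>2 + (\<alpha> + \<beta> + 5)\<^sup>2)) / n')"
      using w n' by (intro mult_left_mono) auto
    finally show ?thesis using n' by simp
  qed
  have Lc: "\<bar>?L c - f' x\<bar> \<le> ?L h"
  proof -
    have e: "?L (\<lambda>i. s * c i + t * f' x) = s * ?L c + t * f' x" for s t
      using durrmeyer_mean_lincomb[OF AB Bc Bfun_const] by (simp add: durrmeyer_mean_const[OF AB])
    have B: "Bseq (\<lambda>i. s * c i + t * f' x)" for s t
      using Bseq_mult[OF Bfun_const Bc, of s] by (simp add: Bseq_add_iff)
    have "?L (\<lambda>i. 1 * c i + (-1) * f' x) \<le> ?L h"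
      by (rule durrmeyer_mean_mono[OF AB y(1,2) B Bh]) (use ch in \<open>auto simp: abs_le_iff\<close>)
    moreover have "?L (\<lambda>i. (-1) * c i + 1 * f' x) \<le> ?L h"
      by (rule durrmeyer_mean_mono[OF AB y(1,2) B Bh]) (use ch in \<open>auto simp: abs_le_iff\<close>)
    ultimately show ?thesis unfolding e by simp
  qed
  define l where "l = q powr (\<alpha> + \<beta> + 2) * n' / N"
  have D: "q_deriv q (q_durrmeyer \<alpha> \<beta> n q f) x = l * ?L c"
    using q_deriv_q_durrmeyer[OF ab _ _ Bg Bc, of x m] \<xi>(3) x
    unfolding l_def n'_def N_def m y_def c_def by simp
  have "N = q_num q (\<alpha> + \<beta> + 2) + q powr (\<alpha> + \<beta> + 2) * n'"
    using q_num_add[OF q0 q1, of "\<alpha> + \<beta> + 2" "real n"] by (simp add: N_def n'_def add_ac)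
  hence l1: "1 - l = q_num q (\<alpha> + \<beta> + 2) / N" using n' by (simp add: l_def field_simps)
  have q2: "q_num q (\<alpha> + \<beta> + 2) > 0" using ab by (intro q_num_pos q0 q1) auto
  have l2: "0 \<le> 1 - l" "1 - l \<le> q_num q (\<alpha> + \<beta> + 2) / n'"
    unfolding l1 using q2 n' by (auto intro!: divide_left_mono)
  have l0: "0 \<le> l" using n' by (simp add: l_def)
  have nf: "\<bar>f' x\<bar> \<le> unif_norm f'" by (rule unif_norm_upper[OF cf' x])
  \<comment> \<open>Only $f'(x)$ itself is hit by the defect $1-\lambda$, so this term carries no further constant.\<close>
  have "\<bar>l * ?L c - f' x\<bar> = \<bar>l * (?L c - f' x) - (1 - l) * f' x\<bar>" by (simp add: algebra_simps)
  also have "\<dots> \<le> l * \<bar>?L c - f' x\<bar> + (1 - l) * \<bar>f' x\<bar>"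
    using abs_triangle_ineq4[of "l * (?L c - f' x)" "(1 - l) * f' x"] l0 l2(1) by (simp add: abs_mult)
  also have "l * \<bar>?L c - f' x\<bar> \<le> 1 * ?L h" using Lc l0 l2 by (intro mult_mono) auto
  also have "(1 - l) * \<bar>f' x\<bar> \<le> q_num q (\<alpha> + \<beta> + 2) / n' * unif_norm f'"
    using l2 nf by (intro mult_mono) auto
  also have "1 * ?L h \<le> (5 + 3 * ((\<alpha> + 3)\<^sup>2 + (\<alpha> + \<beta> + 5)\<^sup>2)) * (w2 + w1)"
  proof -
    have "0 \<le> (3 + 3 * ((\<alpha> + 3)\<^sup>2 + (\<alpha> + \<beta> + 5)\<^sup>2)) * w1" using w by (intro mult_nonneg_nonneg) auto
    thus ?thesis using Lh by (simp add: algebra_simps)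
  qed
  finally show ?thesis unfolding D n'_def[symmetric] \<delta>_def[symmetric] w1_def[symmetric] w2_def[symmetric] by simp
qed

end

text \<open>
  For $n\ge N$, $[n]_q\ge[N]_q=\sum_{j<N}q^j$, and the right-hand side tends to \<open>N\<close> as \<open>q\<close>
  tends to \<open>1\<close>.
\<close>

lemma q_num_filterlim_at_top:
  fixes q :: "nat \<Rightarrow> real"
  assumes "\<And>n. n \<ge> 1 \<Longrightarrow> 0 < q n \<and> q n < 1" "q \<longlonglongrightarrow> 1"
  shows "filterlim (\<lambda>n. q_num (q n) (real n)) at_top sequentially"
  unfolding filterlim_at_top
proof
  fix Z :: real
  obtain N :: nat where N: "Z < real N" using reals_Archimedean2 by blast
  have "(\<lambda>n. \<Sum>j<N. q n ^ j) \<longlonglongrightarrow> (\<Sum>j<N. 1 ^ j)" by (intro tendsto_intros assms(2))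
  hence "eventually (\<lambda>n. Z < (\<Sum>j<N. q n ^ j)) sequentially"
    using N by (intro order_tendstoD(1)) auto
  thus "eventually (\<lambda>n. Z \<le> q_num (q n) (real n)) sequentially"
    using eventually_ge_at_top[of "max 1 N"]
  proof eventually_elim
    case (elim n)
    have q: "0 < q n" "q n < 1" using assms(1)[of n] elim by auto
    have "Z < (\<Sum>j<N. q n ^ j)" by fact
    also have "\<dots> = q_num (q n) (real N)"
      using q by (simp add: q_num_nat sum_gp_strict)
    also have "\<dots> \<le> q_num (q n) (real n)" using elim q by (intro q_num_mono) auto
    finally show ?case by simp
  qed
qed

theorem theorem5:
  fixes \<alpha> \<beta> :: real
  assumes "\<alpha> > -1" and "\<beta> > -1"
  shows "(\<exists>C::real. \<forall>q n f f'. 1/2 < q \<longrightarrow> q < 1 \<longrightarrow> n \<ge> 1 \<longrightarrow> C1_with_deriv f f' \<longrightarrow>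
            unif_norm (\<lambda>x. q_deriv q (q_durrmeyer \<alpha> \<beta> n q f) x - f' x)
            \<le> C * (modulus_of_continuity f' (1 / sqrt (q_num q (real n)))
                   + modulus_of_continuity f' (1 - q))
              + q_num q (\<alpha> + \<beta> + 2) / q_num q (real n) * unif_norm f')
       \<and> (\<forall>(q :: nat \<Rightarrow> real) f f'.
            (\<forall>n\<ge>1. 0 < q n \<and> q n < 1) \<longrightarrow> q \<longlonglongrightarrow> 1 \<longrightarrow> C1_with_deriv f f' \<longrightarrow>
            uniform_limit {0..1} (\<lambda>n x. q_deriv (q n) (q_durrmeyer \<alpha> \<beta> n (q n) f) x) f'
              sequentially)"
proof -
  define C where "C = 5 + 3 * ((\<alpha> + 3)\<^sup>2 + (\<alpha> + \<beta> + 5)\<^sup>2)"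
  define E where "E q n f' = C * (modulus_of_continuity f' (1 / sqrt (q_num q (real n)))
                   + modulus_of_continuity f' (1 - q))
              + q_num q (\<alpha> + \<beta> + 2) / q_num q (real n) * unif_norm f'" for q n f'
  have main: "\<bar>q_deriv q (q_durrmeyer \<alpha> \<beta> n q f) x - f' x\<bar> \<le> E q n f'"
    if "0 < q" "q < 1" "n \<ge> 1" "C1_with_deriv f f'" "x \<in> {0..1}" for q n f f' x
    unfolding E_def C_def by (rule q_deriv_q_durrmeyer_error[OF that(1,2) assms that(3-5)])
  have "unif_norm (\<lambda>x. q_deriv q (q_durrmeyer \<alpha> \<beta> n q f) x - f' x) \<le> E q n f'"
    if "1/2 < q" "q < 1" "n \<ge> 1" "C1_with_deriv f f'" for q n f f'
    unfolding unif_norm_def using that by (intro cSUP_least main) auto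
  moreover have "uniform_limit {0..1} (\<lambda>n x. q_deriv (q n) (q_durrmeyer \<alpha> \<beta> n (q n) f) x) f' sequentially"
    if q: "\<forall>n\<ge>1. 0 < q n \<and> q n < 1" "q \<longlonglongrightarrow> 1" and f: "C1_with_deriv f f'" for q f f'
  proof -
    have cf': "continuous_on {0..1} f'" using f by (simp add: C1_with_deriv_def)
    have top: "filterlim (\<lambda>n. q_num (q n) (real n)) at_top sequentially"
      using q by (intro q_num_filterlim_at_top) auto
    \<comment> \<open>The absolute values make both scales nonnegative at \<open>n = 0\<close> too, where \<open>q 0\<close> is arbitrary.\<close>
    define d where "d n = \<bar>1 / sqrt (q_num (q n) (real n))\<bar>" for n
    define d' where "d' n = \<bar>1 - q n\<bar>" for n
    have "(\<lambda>n. 1 / sqrt (q_num (q n) (real n))) \<longlonglongrightarrow> 0"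
      by (intro tendsto_divide_0[OF tendsto_const] filterlim_at_top_imp_at_infinity
          filterlim_compose[OF sqrt_at_top top])
    hence "d \<longlonglongrightarrow> 0" unfolding d_def by (rule tendsto_rabs_zero)
    from modulus_tendsto_0[OF cf' this] have 1: "(\<lambda>n. modulus_of_continuity f' (d n)) \<longlonglongrightarrow> 0"
      by (simp add: d_def)
    have "(\<lambda>n. 1 - q n) \<longlonglongrightarrow> 0" using tendsto_diff[OF tendsto_const q(2), of 1] by simp
    hence "d' \<longlonglongrightarrow> 0" unfolding d'_def by (rule tendsto_rabs_zero)
    from modulus_tendsto_0[OF cf' this] have 2: "(\<lambda>n. modulus_of_continuity f' (d' n)) \<longlonglongrightarrow> 0"
      by (simp add: d'_def)
    have 3: "(\<lambda>n. (\<alpha> + \<beta> + 3) / q_num (q n) (real n)) \<longlonglongrightarrow> 0"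
      by (intro tendsto_divide_0[OF tendsto_const] filterlim_at_top_imp_at_infinity top)
    define F where "F n = C * (modulus_of_continuity f' (d n) + modulus_of_continuity f' (d' n))
        + (\<alpha> + \<beta> + 3) / q_num (q n) (real n) * unif_norm f'" for n
    have "F \<longlonglongrightarrow> C * (0 + 0) + 0 * unif_norm f'"
      unfolding F_def by (intro tendsto_add tendsto_mult tendsto_const 1 2 3)
    hence F: "F \<longlonglongrightarrow> 0" by simp
    have U: "unif_norm f' \<ge> 0"
      using unif_norm_upper[OF cf', of 0] by simp
    have EF: "E (q n) n f' \<le> F n" if "n \<ge> 1" for n
    proof -
      have qn: "0 < q n" "q n < 1" using q that by auto
      have p: "q_num (q n) (real n) > 0" using that by (intro q_num_pos qn) auto
      have "d n = 1 / sqrt (q_num (q n) (real n))" "d' n = 1 - q n"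
        using p qn by (auto simp: d_def d'_def)
      moreover have "q_num (q n) (\<alpha> + \<beta> + 2) \<le> \<alpha> + \<beta> + 3"
        using q_num_le[OF qn, of "\<alpha> + \<beta> + 2"] assms by simp
      hence "q_num (q n) (\<alpha> + \<beta> + 2) / q_num (q n) (real n) * unif_norm f'
          \<le> (\<alpha> + \<beta> + 3) / q_num (q n) (real n) * unif_norm f'"
        using U p by (intro mult_right_mono divide_right_mono) auto
      ultimately show ?thesis by (simp add: E_def F_def)
    qed
    show ?thesis
    proof (rule uniform_limitI)
      fix e :: real assume "e > 0"
      hence "eventually (\<lambda>n. F n < e) sequentially" using F by (intro order_tendstoD)
      thus "eventually (\<lambda>n. \<forall>x\<in>{0..1}. dist (q_deriv (q n) (q_durrmeyer \<alpha> \<beta> n (q n) f) x) (f' x) < e) sequentially"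
        using eventually_ge_at_top[of 1]
      proof eventually_elim
        case (elim n)
        show ?case
        proof
          fix x :: real assume "x \<in> {0..1}"
          hence "\<bar>q_deriv (q n) (q_durrmeyer \<alpha> \<beta> n (q n) f) x - f' x\<bar> \<le> E (q n) n f'"
            using q elim f by (intro main) auto
          thus "dist (q_deriv (q n) (q_durrmeyer \<alpha> \<beta> n (q n) f) x) (f' x) < e"
            using EF[of n] elim by (simp add: dist_real_def)
        qed
      qed
    qed
  qed
  ultimately show ?thesis unfolding E_def by blast
qed

end
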